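(* Let $G,G_1,\dots,G_t$ be connected graphs with $G_1,\dots,G_t\subseteq G$ and $$t\leq \frac{(\chi(G)-2)(R_2(G)-1)+\sigma(G)-1}{\chi(G)\,|V(G)|}.$$ Then $f(G\cup G_1\cup\cdots\cup G_t,P_5)=R_3(G\cup G_1\cup\cdots\cup G_t)$.
   Context: $\chi(G)$ is the chromatic number. For a $k$-chromatic graph $G$, the chromatic surplus $\sigma(G)$ is the minimum, over all proper $k$-vertex-colorings of $G$, of the minimum size of a color class. $\cup$ denotes vertex-disjoint union and $\subseteq$ means subgraph. $P_5$ is the path on $5$ vertices. Monochromatic: all edges same color; rainbow: all edges distinct colors. $f(H,G)$ is the minimum $n$ such that every edge-coloring of $K_n$ with any number of colors contains a monochromatic $H$ or a rainbow $G$. $R_k(H)$ is the minimum $n$ such that every coloring of $E(K_n)$ with colors from $\{1,\dots,k\}$ (not all need be used) contains a monochromatic $H$. *)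

theory Defs
  imports Complex_Main "HOL-Library.Ramsey" "HOL-Library.FuncSet"
begin

record 'a sgraph =
  verts :: "'a set"
  edges :: "'a set set"

definition fin_graph :: "'a sgraph \<Rightarrow> bool" where
  "fin_graph G \<longleftrightarrow> finite (verts G) \<and> edges G \<subseteq> nsets (verts G) 2"

definition connected_graph :: "'a sgraph \<Rightarrow> bool" where
  "connected_graph G \<longleftrightarrow> fin_graph G \<and> verts G \<noteq> {} \<and>
     (\<forall>u\<in>verts G. \<forall>v\<in>verts G. (u, v) \<in> {(x, y). {x, y} \<in> edges G}\<^sup>*)"

definition complete_graph :: "nat \<Rightarrow> nat sgraph" where
  "complete_graph n = \<lparr>verts = {..<n}, edges = nsets {..<n} 2\<rparr>"

text \<open>The path on \<open>n\<close> vertices (so with \<open>n - 1\<close> edges).\<close>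

definition path_graph :: "nat \<Rightarrow> nat sgraph" where
  "path_graph n = \<lparr>verts = {..<n}, edges = {{i, Suc i} | i. Suc i < n}\<rparr>"

definition embedding :: "('a \<Rightarrow> 'b) \<Rightarrow> 'a sgraph \<Rightarrow> 'b sgraph \<Rightarrow> bool" where
  "embedding \<phi> H G \<longleftrightarrow> inj_on \<phi> (verts H) \<and> \<phi> ` verts H \<subseteq> verts G \<and>
     (\<forall>e\<in>edges H. \<phi> ` e \<in> edges G)"

text \<open>The subgraph relation is taken up to isomorphism: \<open>G\<close> contains a (not necessarily
  induced) copy of \<open>H\<close>. Literal subgraphs are the case where the embedding is the identity.\<close>

definition is_subgraph :: "'a sgraph \<Rightarrow> 'b sgraph \<Rightarrow> bool" where
  "is_subgraph H G \<longleftrightarrow> (\<exists>\<phi>. embedding \<phi> H G)"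

text \<open>Vertices are tagged by their position in the list, so the members of the list
  need not be disjoint to begin with.\<close>

definition disjoint_union :: "'a sgraph list \<Rightarrow> (nat \<times> 'a) sgraph" where
  "disjoint_union Gs =
     \<lparr>verts = (SIGMA i:{..<length Gs}. verts (Gs ! i)),
      edges = (\<Union>i<length Gs. (\<lambda>e. Pair i ` e) ` edges (Gs ! i))\<rparr>"

definition proper_colorings :: "'a sgraph \<Rightarrow> nat \<Rightarrow> ('a \<Rightarrow> nat) set" where
  "proper_colorings G k =
     {c \<in> verts G \<rightarrow> {..<k}. \<forall>u v. {u, v} \<in> edges G \<longrightarrow> c u \<noteq> c v}"

definition chromatic_number :: "'a sgraph \<Rightarrow> nat" where
  "chromatic_number G = (LEAST k. proper_colorings G k \<noteq> {})"

definition chromatic_surplus :: "'a sgraph \<Rightarrow> nat" where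
  "chromatic_surplus G =
     (INF c\<in>proper_colorings G (chromatic_number G).
        MIN i\<in>{..<chromatic_number G}. card {v \<in> verts G. c v = i})"

text \<open>An edge-coloring of the complete graph on \<open>n\<close> vertices is a function on sets of vertices
  of which only the values on the 2-element subsets of \<open>{..<n}\<close> are relevant. As that graph is
  finite, natural numbers suffice as colors also when the number of colors is unrestricted.\<close>

definition has_mono_copy :: "nat \<Rightarrow> (nat set \<Rightarrow> nat) \<Rightarrow> 'a sgraph \<Rightarrow> bool" where
  "has_mono_copy n col H \<longleftrightarrow> (\<exists>\<phi>. embedding \<phi> H (complete_graph n) \<and>
     (\<forall>e\<in>edges H. \<forall>e'\<in>edges H. col (\<phi> ` e) = col (\<phi> ` e')))"

definition has_rainbow_copy :: "nat \<Rightarrow> (nat set \<Rightarrow> nat) \<Rightarrow> 'a sgraph \<Rightarrow> bool" where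
  "has_rainbow_copy n col G \<longleftrightarrow> (\<exists>\<phi>. embedding \<phi> G (complete_graph n) \<and>
     (\<forall>e\<in>edges G. \<forall>e'\<in>edges G. e \<noteq> e' \<longrightarrow> col (\<phi> ` e) \<noteq> col (\<phi> ` e')))"

definition ramsey_number :: "nat \<Rightarrow> 'a sgraph \<Rightarrow> nat" where
  "ramsey_number k H =
     (LEAST n. \<forall>col \<in> edges (complete_graph n) \<rightarrow> {1..k}. has_mono_copy n col H)"

definition constrained_ramsey_number :: "'a sgraph \<Rightarrow> 'b sgraph \<Rightarrow> nat" where
  "constrained_ramsey_number H G =
     (LEAST n. \<forall>col. has_mono_copy n col H \<or> has_rainbow_copy n col G)"

end

theory Submission imports Defs begin

text \<open>
  Three colors cannot make a path with four edges rainbow, so only the upper bound needs work.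
  Let \<open>n = R\<^sub>3(H)\<close> for \<open>H = G \<union> G\<^sub>1 \<union> \<dots> \<union> G\<^sub>t\<close>. Joining \<open>\<chi>(G) - 1\<close> blocks of \<open>R\<^sub>2(G) - 1\<close>
  vertices and one block of \<open>\<sigma>(G) - 1\<close> vertices by a third color gives
  \<open>n > (\<chi>(G) - 1)(R\<^sub>2(G) - 1) + \<sigma>(G) - 1\<close>, and with the assumption on \<open>t\<close> this becomes
  \<open>n \<ge> R\<^sub>2(G) + t \<chi>(G) |V(G)|\<close>.

  A coloring with at least four colors and without rainbow \<open>P\<^sub>5\<close> on at least six vertices has a color
  \<open>k\<close> which is either dominant (at every vertex at most one other color occurs), or is the color of
  all edges that avoid one vertex and do not lie inside one triple (a weakening of a theorem of
  Thomason and Wagner). In the second case \<open>H\<close> embeds into color \<open>k\<close>, an independent set of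
  at most three vertices being mapped into the triple. In the first case
  remove a maximal family of disjoint copies of \<open>G\<close> in color \<open>k\<close>. If it has at most \<open>t\<close> members,
  then the remaining vertices contain many disjoint monochromatic copies of \<open>G\<close> in other colors;
  copies of different colors are completely joined in color \<open>k\<close>, so fewer than \<open>\<chi>(G)\<close> colors occur
  among them, and one of these colors occurs more than \<open>t\<close> times.
\<close>

section \<open>Colorings without rainbow path on five vertices\<close>

locale rainbow_P5_free =
  fixes V :: "'v set" and col :: "'v set \<Rightarrow> 'c"
  assumes path: "\<lbrakk>distinct [u, v, w, x, y]; {u, v, w, x, y} \<subseteq> V\<rbrakk>
    \<Longrightarrow> \<not> distinct [col {u, v}, col {v, w}, col {w, x}, col {x, y}]"
begin

text \<open>
  A core on five or six vertices restricts the edges at every further vertex so much that the whole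
  coloring is dominant or almost monochromatic. Most of the explicit lists of paths in the proofs
  below come from a computer search for small sets of instances that force the claim.
\<close>

definition tri_ext :: "'c \<Rightarrow> 'v \<Rightarrow> 'v \<Rightarrow> 'v \<Rightarrow> 'v \<Rightarrow> bool" where
  "tri_ext k a b d x \<longleftrightarrow>
     col {a, x} \<in> {k, col {b, d}} \<and> col {b, x} \<in> {k, col {a, d}} \<and> col {d, x} \<in> {k, col {a, b}}"

definition tri_core :: "'c \<Rightarrow> 'v \<Rightarrow> 'v \<Rightarrow> 'v \<Rightarrow> 'v \<Rightarrow> 'v \<Rightarrow> bool" where
  "tri_core k a b d x y \<longleftrightarrow> distinct [a, b, d, x, y] \<and> {a, b, d, x, y} \<subseteq> V \<and>
     distinct [k, col {a, b}, col {a, d}, col {b, d}] \<and> col {x, y} = k \<and>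
     tri_ext k a b d x \<and> tri_ext k a b d y"

definition star_core :: "'c \<Rightarrow> 'v \<Rightarrow> 'v \<Rightarrow> 'v \<Rightarrow> 'v \<Rightarrow> 'v \<Rightarrow> bool" where
  "star_core k a b d e x \<longleftrightarrow> distinct [a, b, d, e, x] \<and> {a, b, d, e, x} \<subseteq> V \<and>
     distinct [k, col {a, b}, col {a, d}, col {a, e}] \<and>
     col {b, d} = k \<and> col {b, e} = k \<and> col {d, e} = k \<and>
     col {b, x} = k \<and> col {d, x} = k \<and> col {e, x} = k"

definition dom_core :: "'c \<Rightarrow> 'v \<Rightarrow> 'v \<Rightarrow> 'v \<Rightarrow> 'v \<Rightarrow> 'v \<Rightarrow> 'v \<Rightarrow> bool" where
  "dom_core k a b d e x y \<longleftrightarrow> distinct [a, b, d, e, x, y] \<and> {a, b, d, e, x, y} \<subseteq> V \<and>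
     distinct [k, col {a, b}, col {d, e}, col {x, y}] \<and>
     (\<forall>u\<in>{a, b}. \<forall>v\<in>{d, e}. col {u, v} = k) \<and>
     (\<forall>u\<in>{a, b}. \<forall>v\<in>{x, y}. col {u, v} = k) \<and>
     (\<forall>u\<in>{d, e}. \<forall>v\<in>{x, y}. col {u, v} = k)"

definition dominant :: "'c \<Rightarrow> bool" where
  "dominant k \<longleftrightarrow> (\<forall>x\<in>V. \<forall>y\<in>V. \<forall>z\<in>V. x \<noteq> y \<longrightarrow> x \<noteq> z \<longrightarrow>
     col {x, y} = k \<or> col {x, z} = k \<or> col {x, y} = col {x, z})"

definition almost_mono :: "'c \<Rightarrow> bool" where
  "almost_mono k \<longleftrightarrow> (\<exists>a b d e. distinct [a, b, d, e] \<and> {a, b, d, e} \<subseteq> V \<and>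
     (\<forall>u\<in>V - {a}. \<forall>v\<in>V - {a}. u \<noteq> v \<longrightarrow> \<not> {u, v} \<subseteq> {b, d, e} \<longrightarrow> col {u, v} = k))"

lemma tri_core_swap:
  assumes "tri_core k a b d x y"
  shows "tri_core k b a d x y" "tri_core k d b a x y" "tri_core k a b d y x"
  using assms by (auto simp: tri_core_def tri_ext_def insert_commute)

lemma tri_core_edge:
  assumes "tri_core k a b d x y" "v \<in> V" "v \<notin> {a, b, d, x, y}"
  shows "col {a, v} \<in> {k, col {b, d}}"
  using assms path[of v a b d x] path[of d x y a v] path[of v a d b x] path[of b y x a v]
    path[of b d y a v] path[of v a d b y] path[of d b x a v] path[of v a b d y]
  unfolding tri_core_def tri_ext_def
  by (simp add: insert_commute) (smt (verit))

lemma tri_core_ext: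
  assumes "tri_core k a b d x y" "v \<in> V" "v \<notin> {a, b, d}"
  shows "tri_ext k a b d v"
proof (cases "v \<in> {x, y}")
  case True
  then show ?thesis using assms(1) by (auto simp: tri_core_def)
next
  case False
  then have v: "v \<notin> {a, b, d, x, y}" "v \<notin> {b, a, d, x, y}" "v \<notin> {d, b, a, x, y}"
    using assms(3) by auto
  show ?thesis
    using tri_core_edge[OF assms(1,2) v(1)]
      tri_core_edge[OF tri_core_swap(1)[OF assms(1)] assms(2) v(2)]
      tri_core_edge[OF tri_core_swap(2)[OF assms(1)] assms(2) v(3)]
    by (simp add: tri_ext_def insert_commute)
qed

lemma tri_core_outside:
  assumes t: "tri_core k a b d x y" and v: "v \<in> V" "v \<notin> {a, b, d, x}"
  shows "col {x, v} = k"
proof (cases "v = y")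
  case True
  then show ?thesis using t by (simp add: tri_core_def)
next
  case False
  have "tri_ext k a b d v" using tri_core_ext[OF t] v by auto
  then show ?thesis using t v False
    path[of a d b v x] path[of a d v x y] path[of d b a v x] path[of b a d v x] path[of b a v x y]
    path[of b d a x v] path[of v b a x y]
    unfolding tri_core_def tri_ext_def
    by (simp add: insert_commute) (smt (verit))
qed

lemma tri_core_outside2:
  assumes t: "tri_core k a b d x y" and uv: "u \<in> V - {a, b, d}" "v \<in> V - {a, b, d}" "u \<noteq> v"
  shows "col {u, v} = k"
proof (cases "u = x")
  case True
  then show ?thesis using tri_core_outside[OF t] uv by auto
next
  case False
  have "col {x, u} = k" using tri_core_outside[OF t] uv False by auto
  then have "tri_core k a b d u x"
    using t tri_core_ext[OF t] uv(1) False by (auto simp: tri_core_def insert_commute)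
  from tri_core_outside[OF this] show ?thesis using uv by auto
qed

lemma star_core_step:
  assumes s: "star_core k a b d e x" and v: "v \<in> V" "v \<notin> {a, b, d, e, x}"
  shows "col {x, v} = k \<and> col {b, v} = k \<and> col {d, v} = k \<and> col {e, v} = k"
  using assms path[of b a e x v] path[of b a d x v] path[of d a e x v] 
    path[of x e a b v] path[of e d a b v] path[of e a d b v] 
    path[of x e a d v] path[of e b a d v] path[of e a b d v]
    path[of x d a e v] path[of d b a e v] path[of d a b e v]
  unfolding star_core_def
  by (simp add: insert_commute) (smt (verit))

lemma star_core_mono:
  assumes s: "star_core k a b d e x" and uv: "u \<in> V - {a}" "v \<in> V - {a}" "u \<noteq> v"
  shows "col {u, v} = k"
proof -
  have in_core: "col {u, v} = k" if "u \<in> {b, d, e, x}" "v \<in> V - {a}" "u \<noteq> v" for u v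
  proof (cases "v \<in> {b, d, e, x}")
    case True
    then show ?thesis using s that by (auto simp: star_core_def insert_commute)
  next
    case False
    then show ?thesis using star_core_step[OF s, of v] that by auto
  qed
  show ?thesis
  proof (cases "u \<in> {b, d, e, x} \<or> v \<in> {b, d, e, x}")
    case True
    then show ?thesis using in_core[of u v] in_core[of v u] uv by (auto simp: insert_commute)
  next
    case False
    then have "star_core k a b d e u"
      using s in_core[of _ u] uv unfolding star_core_def by auto
    from star_core_step[OF this] show ?thesis using uv False by auto
  qed
qed

lemma paw_core:
  assumes "distinct [p, q, r, s, w]" "{p, q, r, s, w} \<subseteq> V"
    "distinct [col {p, q}, col {q, r}, col {p, r}, col {r, s}]"
  shows "tri_core (col {p, w}) q r s p w \<or> tri_core (col {q, w}) p r s q w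
    \<or> tri_core (col {s, w}) p q r s w \<or> tri_core (col {r, s}) p q w r s
    \<or> star_core (col {p, q}) r p q s w"
  using assms
    path[of q w p r s] path[of p r q w s] path[of p s q r w] path[of q p w r s] path[of p w r s q]
    path[of r s p q w] path[of q p r w s] path[of s p q r w] path[of s p r q w] path[of s r q p w]
    path[of q p r s w] path[of p q r s w] path[of r p q s w] path[of q r p w s] path[of q p s r w]
    path[of r q p s w] path[of q w r p s] path[of p w q r s] path[of p s w q r] path[of q s r p w]
    path[of s q r p w] path[of p s r q w] path[of s r p q w]
  unfolding tri_core_def tri_ext_def star_core_def
  by (simp add: insert_commute) (smt (verit))

definition rainbow_paw :: "'v \<Rightarrow> 'v \<Rightarrow> 'v \<Rightarrow> 'v \<Rightarrow> bool" where
  "rainbow_paw p q r s \<longleftrightarrow> distinct [p, q, r, s] \<and> {p, q, r, s} \<subseteq> V \<and>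
     distinct [col {p, q}, col {q, r}, col {p, r}, col {r, s}]"

lemma C4_paw:
  assumes "distinct [p, q, r, s]" "{p, q, r, s} \<subseteq> V"
    "distinct [col {p, q}, col {q, r}, col {r, s}, col {p, s}]"
  shows "\<exists>p q r s. rainbow_paw p q r s"
proof -
  have "rainbow_paw p q r s \<or> rainbow_paw s r p q \<or> rainbow_paw s p r q \<or> rainbow_paw q r p s"
    using assms unfolding rainbow_paw_def by (simp add: insert_commute) metis
  then show ?thesis by blast
qed

lemma chair_paw:
  assumes "distinct [p, q, r, s, w]" "{p, q, r, s, w} \<subseteq> V"
    "distinct [col {p, q}, col {q, r}, col {r, s}, col {q, w}]"
  shows "\<exists>p q r s. rainbow_paw p q r s"
proof -
  have "rainbow_paw p q r s \<or> rainbow_paw p r q w \<or> rainbow_paw p w q r \<or> rainbow_paw w q r s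
      \<or> rainbow_paw w r q p"
    using assms path[of p q w r s] path[of s r q p w] path[of q p w r s] path[of p w q r s]
    unfolding rainbow_paw_def by (simp add: insert_commute) (smt (verit))
  then show ?thesis by blast
qed

lemma disjoint_edge_end:
  assumes "distinct [p, q, r, s, v, w]" "{p, q, r, s, v, w} \<subseteq> V"
    "distinct [col {p, q}, col {q, r}, col {r, s}, col {v, w}]"
  shows "col {p, v} = col {q, r} \<and> col {s, w} = col {q, r} \<or>
     col {p, v} = col {p, q} \<and> col {s, w} = col {r, s}"
  using assms path[of p q r s w] path[of q r s w v] path[of r q p v w] path[of q p v w s]
    path[of s r q p v] path[of p v w s r]
  by (simp add: insert_commute) (smt (verit))

lemma disjoint_edge_end':
  assumes "distinct [p, q, r, s, v, w]" "{p, q, r, s, v, w} \<subseteq> V"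
    "distinct [col {p, q}, col {q, r}, col {r, s}, col {v, w}]"
  shows "col {p, v} = col {q, r}"
proof -
  have "distinct [p, q, r, s, w, v]" "{p, q, r, s, w, v} \<subseteq> V"
    "distinct [col {p, q}, col {q, r}, col {r, s}, col {w, v}]"
    using assms by (auto simp: insert_commute)
  from disjoint_edge_end[OF assms] disjoint_edge_end[OF this] assms show ?thesis
    using path[of p r s v w] path[of p w v r s] path[of q r p v w] path[of r p v s w] path[of q r v w s]
      path[of p q r v s] path[of p q r v w] path[of r p v w s]
    by (simp add: insert_commute) (smt (verit))
qed

lemma disjoint_edge_inner:
  assumes "distinct [p, q, r, s, v, w]" "{p, q, r, s, v, w} \<subseteq> V"
    "distinct [col {p, q}, col {q, r}, col {r, s}, col {v, w}]"
    "col {p, v} = col {q, r}" "col {p, w} = col {q, r}" "col {s, v} = col {q, r}" "col {s, w} = col {q, r}"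
  shows "col {q, v} = col {q, r}"
  using assms path[of p q v w s] path[of p q v s r] path[of q v w s r]
  by (simp add: insert_commute) (smt (verit))

lemma disjoint_edge_dom_core:
  assumes A: "distinct [p, q, r, s, v, w]" "{p, q, r, s, v, w} \<subseteq> V"
    "distinct [col {p, q}, col {q, r}, col {r, s}, col {v, w}]"
  shows "dom_core (col {q, r}) p q r s v w"
proof -
  let ?k = "col {q, r}"
  have B: "distinct [p, q, r, s, w, v]" "{p, q, r, s, w, v} \<subseteq> V"
      "distinct [col {p, q}, col {q, r}, col {r, s}, col {w, v}]"
    and C: "distinct [s, r, q, p, v, w]" "{s, r, q, p, v, w} \<subseteq> V"
      "distinct [col {s, r}, col {r, q}, col {q, p}, col {v, w}]"
    and D: "distinct [s, r, q, p, w, v]" "{s, r, q, p, w, v} \<subseteq> V"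
      "distinct [col {s, r}, col {r, q}, col {q, p}, col {w, v}]"
    using A by (auto simp: insert_commute)
  have ends: "col {p, v} = ?k" "col {p, w} = ?k" "col {s, v} = ?k" "col {s, w} = ?k"
    using disjoint_edge_end'[OF A] disjoint_edge_end'[OF B] disjoint_edge_end'[OF C]
      disjoint_edge_end'[OF D] by (simp_all add: insert_commute)
  have inner: "col {q, v} = ?k" "col {q, w} = ?k" "col {r, v} = ?k" "col {r, w} = ?k"
    using disjoint_edge_inner[OF A] disjoint_edge_inner[OF B] disjoint_edge_inner[OF C]
      disjoint_edge_inner[OF D] ends by (simp_all add: insert_commute)
  have "col {p, r} = ?k"
    using A ends inner path[of s r p q v] path[of r p q v w] path[of p r s w v]
    by (simp add: insert_commute) (smt (verit))
  moreover have "col {q, s} = ?k"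
    using A ends inner path[of p q s r v] path[of q s r v w] path[of s q p w v]
    by (simp add: insert_commute) (smt (verit))
  moreover have "col {p, s} = ?k"
    using A ends inner path[of q p s w v] path[of p s r w v] path[of q p s r w]
    by (simp add: insert_commute) (smt (verit))
  ultimately show ?thesis
    using A ends inner by (auto simp: dom_core_def insert_commute)
qed

lemma ex_fresh:
  assumes "card V \<ge> 6" "length xs < 6"
  shows "\<exists>w\<in>V. w \<notin> set xs"
proof (rule ccontr)
  assume "\<not> ?thesis"
  then have "card V \<le> card (set xs)" by (intro card_mono) auto
  then show False using card_length[of xs] assms by simp
qed

lemma tri_core_cross:
  assumes t: "tri_core k a b d p q" and V: "card V \<ge> 6"
    and xy: "x \<in> V - {a, b, d}" "y \<in> V - {a, b, d}" "x \<noteq> y"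
  shows "col {a, x} = k \<or> col {b, y} = k"
proof -
  obtain z where z: "z \<in> V" "z \<notin> {a, b, d, x, y}"
    using ex_fresh[OF V, of "[a, b, d, x, y]"] by auto
  have "tri_ext k a b d x" "tri_ext k a b d y" "col {y, z} = k"
    using tri_core_ext[OF t] tri_core_outside2[OF t] xy z by auto
  then show ?thesis
    using path[of x a b y z] t xy z unfolding tri_core_def tri_ext_def
    by (simp add: insert_commute) (smt (verit))
qed

lemma tri_core_centre:
  assumes t: "tri_core k a b d p q"
    and triv: "\<And>x. x \<in> V - {a, b, d} \<Longrightarrow> col {b, x} = k \<and> col {d, x} = k"
  shows "almost_mono k"
proof -
  have "\<forall>u\<in>V - {a}. \<forall>v\<in>V - {a}. u \<noteq> v \<longrightarrow> \<not> {u, v} \<subseteq> {b, d, p} \<longrightarrow> col {u, v} = k"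
  proof (intro ballI impI)
    fix u v assume uv: "u \<in> V - {a}" "v \<in> V - {a}" "u \<noteq> v" "\<not> {u, v} \<subseteq> {b, d, p}"
    show "col {u, v} = k"
      using uv triv[of u] triv[of v] tri_core_outside2[OF t, of u v]
      by (cases "u \<in> {b, d}"; cases "v \<in> {b, d}") (auto simp: insert_commute)
  qed
  then show ?thesis
    using t unfolding almost_mono_def tri_core_def
    by (intro exI[of _ a] exI[of _ b] exI[of _ d] exI[of _ p]) simp
qed

lemma tri_core_almost_mono:
  assumes t: "tri_core k a b d p q" and V: "card V \<ge> 6"
  shows "almost_mono k"
proof -
  define S where "S = {a, b, d}"
  note perms = t tri_core_swap(1)[OF t] tri_core_swap(2)[OF t]
    tri_core_swap(2)[OF tri_core_swap(1)[OF t]] tri_core_swap(1)[OF tri_core_swap(2)[OF t]]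
    tri_core_swap(1)[OF tri_core_swap(2)[OF tri_core_swap(1)[OF t]]]
  have cross: "u = u'" if "u \<in> S" "u' \<in> S" "x \<in> V - S" "x' \<in> V - S" "x \<noteq> x'"
    "col {u, x} \<noteq> k" "col {u', x'} \<noteq> k" for u u' x x'
    using that perms[THEN tri_core_cross, OF V, of x x'] unfolding S_def
    by (auto simp: insert_commute)
  show ?thesis
  proof (cases "\<exists>x0\<in>V - S. \<forall>x\<in>V - S - {x0}. \<forall>u\<in>S. col {u, x} = k")
    case True
    then obtain x0 where x0: "x0 \<in> V - S" and triv: "\<And>x u. x \<in> V - S - {x0} \<Longrightarrow> u \<in> S \<Longrightarrow> col {u, x} = k"
      by blast
    have "\<forall>u\<in>V - {x0}. \<forall>v\<in>V - {x0}. u \<noteq> v \<longrightarrow> \<not> {u, v} \<subseteq> S \<longrightarrow> col {u, v} = k"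
    proof (intro ballI impI)
      fix u v assume uv: "u \<in> V - {x0}" "v \<in> V - {x0}" "u \<noteq> v" "\<not> {u, v} \<subseteq> S"
      show "col {u, v} = k"
        using uv triv[of u v] triv[of v u] tri_core_outside2[OF t, of u v]
        by (cases "u \<in> S"; cases "v \<in> S") (auto simp: insert_commute S_def)
    qed
    then show ?thesis
      using t x0 unfolding almost_mono_def tri_core_def S_def
      by (intro exI[of _ x0] exI[of _ a] exI[of _ b] exI[of _ d]) simp
  next
    case False
    have "p \<in> V - S" using t by (auto simp: tri_core_def S_def)
    with False obtain x u where xu: "x \<in> V - S" "u \<in> S" "col {u, x} \<noteq> k" by blast
    with False obtain y u' where yu: "y \<in> V - S" "y \<noteq> x" "u' \<in> S" "col {u', y} \<noteq> k" by blast
    have "u' = u" using cross[of u u' x y] xu yu by auto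
    have centre: "w = u" if "z \<in> V - S" "w \<in> S" "col {w, z} \<noteq> k" for w z
      using cross[of w u z x] cross[of w u z y] xu yu that \<open>u' = u\<close> by auto
    have triv: "col {w, z} = k" if "z \<in> V - S" "w \<in> S" "w \<noteq> u" for w z
      using centre that by blast
    have d: "distinct [a, b, d]" using t by (simp add: tri_core_def)
    from xu(2) consider "u = a" | "u = b" | "u = d" unfolding S_def by blast
    then show ?thesis
    proof cases
      case 1
      then have "col {b, z} = k \<and> col {d, z} = k" if "z \<in> V - {a, b, d}" for z
        using triv[of z b] triv[of z d] that d by (auto simp: S_def)
      then show ?thesis by (rule tri_core_centre[OF t])
    next
      case 2
      then have "col {a, z} = k \<and> col {d, z} = k" if "z \<in> V - {b, a, d}" for z
        using triv[of z a] triv[of z d] that d by (auto simp: S_def)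
      then show ?thesis by (rule tri_core_centre[OF perms(2)])
    next
      case 3
      then have "col {b, z} = k \<and> col {a, z} = k" if "z \<in> V - {d, b, a}" for z
        using triv[of z a] triv[of z b] that d by (auto simp: S_def)
      then show ?thesis by (rule tri_core_centre[OF perms(3)])
    qed
  qed
qed

lemma star_core_almost_mono:
  assumes s: "star_core k a b d e x"
  shows "almost_mono k"
proof -
  have "\<forall>u\<in>V - {a}. \<forall>v\<in>V - {a}. u \<noteq> v \<longrightarrow> \<not> {u, v} \<subseteq> {b, d, e} \<longrightarrow> col {u, v} = k"
    using star_core_mono[OF s] by blast
  then show ?thesis
    using s unfolding almost_mono_def star_core_def
    by (intro exI[of _ a] exI[of _ b] exI[of _ d] exI[of _ e]) simp
qed

lemma dom_core_swap:
  assumes "dom_core k a b d e x y"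
  shows "dom_core k b a d e x y" "dom_core k d e a b x y" "dom_core k x y d e a b"
  using assms unfolding dom_core_def by (auto simp: insert_commute)

lemma dom_core_perms:
  assumes "dom_core k a b d e x y"
  shows "dom_core k a b d e x y" "dom_core k b a d e x y" "dom_core k d e a b x y"
    "dom_core k e d a b x y" "dom_core k x y d e a b" "dom_core k y x d e a b"
  using dom_core_swap[OF assms] dom_core_swap(1)[OF dom_core_swap(2)[OF assms]]
    dom_core_swap(1)[OF dom_core_swap(3)[OF assms]] assms by simp_all

lemma dom_core_edge:
  assumes D: "dom_core k a b d e x y" and v: "v \<in> V" "v \<notin> {a, b, d, e, x, y}"
  shows "col {a, v} = k \<or> col {a, v} = col {a, b}"
  using assms path[of v a b d e] path[of v a b x y]
  unfolding dom_core_def by (simp add: insert_commute) (smt (verit))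

lemma dom_core_two:
  assumes D: "dom_core k a b d e x y" and v: "v \<in> V" "v \<notin> {a, b, d, e, x, y}"
  shows "col {a, v} = k \<or> col {d, v} = k"
proof -
  have "col {a, v} = k \<or> col {a, v} = col {a, b}" "col {d, v} = k \<or> col {d, v} = col {d, e}"
    using dom_core_edge[OF D v] dom_core_edge[OF dom_core_swap(2)[OF D]] v by auto
  then show ?thesis
    using D v path[of y x a v d] unfolding dom_core_def
    by (simp add: insert_commute) (smt (verit))
qed

lemma dom_core_inside:
  assumes D: "dom_core k a b d e x y" and v: "v \<in> V" "v \<noteq> a"
  shows "col {a, v} = k \<or> col {a, v} = col {a, b}"
proof (cases "v \<in> {a, b, d, e, x, y}")
  case True
  then show ?thesis using D v by (auto simp: dom_core_def)
next
  case False
  then show ?thesis using dom_core_edge[OF D] v by blast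
qed

lemma dom_core_touch:
  assumes D: "dom_core k a b d e x y" and u: "u \<in> V" "u \<notin> {a, b, d, e, x, y}"
    and w: "w \<in> V" "w \<noteq> u" "w \<noteq> a"
  shows "col {u, a} = k \<or> col {u, w} = k \<or> col {u, w} = col {u, a}"
proof (cases "w \<in> {b, d, e, x, y}")
  case True
  note P = dom_core_perms[OF D]
  have "dom_core k a b e d x y" "dom_core k a b x y d e" "dom_core k a b y x d e"
    using D unfolding dom_core_def by (auto simp: insert_commute)
  from this[THEN dom_core_two, of u] dom_core_two[OF D u]
  have "w \<in> {d, e, x, y} \<Longrightarrow> ?thesis" using u by (auto simp: insert_commute)
  moreover have "w = b \<Longrightarrow> ?thesis"
    using dom_core_edge[OF D u] dom_core_edge[OF P(2) u(1)] u by (auto simp: insert_commute)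
  ultimately show ?thesis using True by blast
next
  case False
  then show ?thesis
    using D u w dom_core_edge[OF D u] path[of w u a d e] path[of w u a x y]
    unfolding dom_core_def by (simp add: insert_commute) (smt (verit))
qed

lemma dom_core_outside:
  assumes D: "dom_core k a b d e x y" and T: "{u, v, w} \<subseteq> V - {a, b, d, e, x, y}"
    and d: "distinct [u, v, w]" and c: "col {a, b} \<noteq> col {u, v}" "col {a, b} \<noteq> col {u, w}"
  shows "col {u, v} = k \<or> col {u, w} = k \<or> col {u, v} = col {u, w}"
proof -
  have "col {a, v} = k \<or> col {a, v} = col {a, b}" using dom_core_edge[OF D, of v] T by auto
  then show ?thesis
    using D T d c path[of w u v a b] path[of w u v a d]
    unfolding dom_core_def by (simp add: insert_commute) (smt (verit))
qed

lemma dom_core_dominant: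
  assumes D: "dom_core k a b d e x y"
  shows "dominant k"
  unfolding dominant_def
proof (intro ballI impI)
  fix u v w assume V: "u \<in> V" "v \<in> V" "w \<in> V" and ne: "u \<noteq> v" "u \<noteq> w"
  define T where "T = {a, b, d, e, x, y}"
  note P = dom_core_perms[OF D]
  have touch: "col {u, v} = k \<or> col {u, w} = k \<or> col {u, v} = col {u, w}"
    if "u \<notin> T" "v \<in> T" "w \<noteq> u" "u \<in> V" "w \<in> V" for u v w
    using that P[THEN dom_core_touch, of u w] by (cases "w = v") (auto simp: T_def)
  show "col {u, v} = k \<or> col {u, w} = k \<or> col {u, v} = col {u, w}"
  proof (cases "u \<in> T")
    case True
    then show ?thesis
      using P[THEN dom_core_inside, of v] P[THEN dom_core_inside, of w] V ne by (auto simp: T_def)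
  next
    case u: False
    show ?thesis
    proof (cases "v \<in> T \<or> w \<in> T \<or> v = w")
      case True
      then show ?thesis using touch[of u v w] touch[of u w v] u V ne by metis
    next
      case False
      have "distinct [col {a, b}, col {d, e}, col {x, y}]" using D by (simp add: dom_core_def)
      then have "col {a, b} \<notin> {col {u, v}, col {u, w}} \<or> col {d, e} \<notin> {col {u, v}, col {u, w}}
          \<or> col {x, y} \<notin> {col {u, v}, col {u, w}}"
        by auto
      then show ?thesis
        using P(1,3,5)[THEN dom_core_outside, of u v w] u False V ne by (auto simp: T_def)
    qed
  qed
qed

lemma rainbow_P4_exists:
  assumes V: "card V \<ge> 6"
    and many: "\<And>\<alpha> \<beta>. \<exists>x\<in>V. \<exists>y\<in>V. x \<noteq> y \<and> col {x, y} \<notin> {\<alpha>, \<beta>}"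
  obtains p q r s where "distinct [p, q, r, s]" "{p, q, r, s} \<subseteq> V"
    "distinct [col {p, q}, col {q, r}, col {r, s}]"
proof (rule ccontr)
  note found = that
  assume "\<not> thesis"
  then have no: "\<not> distinct [col {p, q}, col {q, r}, col {r, s}]"
    if "distinct [p, q, r, s]" "{p, q, r, s} \<subseteq> V" for p q r s
    using that found by blast
  have "\<exists>x y z. distinct [x, y, z] \<and> {x, y, z} \<subseteq> V \<and> col {x, y} \<noteq> col {y, z}"
  proof (rule ccontr)
    assume "\<not> ?thesis"
    then have *: "col {x, y} = col {y, z}" if "distinct [x, y, z]" "{x, y, z} \<subseteq> V" for x y z
      using that by blast
    obtain x y where xy: "x \<in> V" "y \<in> V" "x \<noteq> y" using many by blast
    obtain u v where uv: "u \<in> V" "v \<in> V" "u \<noteq> v" "col {u, v} \<noteq> col {x, y}" using many by blast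
    have inc: "col {p, q} = col {q, r}" if "{p, q, r} \<subseteq> V" "p \<noteq> q" "q \<noteq> r" for p q r
      using *[of p q r] that by (cases "p = r") (simp_all add: insert_commute)
    show False
      using inc[of x y u] inc[of y u v] inc[of x y v] uv xy
      by (cases "y = u") (simp_all add: insert_commute)
  qed
  then obtain x y z where xyz: "distinct [x, y, z]" "{x, y, z} \<subseteq> V" "col {x, y} \<noteq> col {y, z}"
    by blast
  obtain w where w: "w \<in> V" "w \<notin> {x, y, z}"
    using ex_fresh[OF V, of "[x, y, z]"] by auto
  obtain w' where w': "w' \<in> V" "w' \<notin> {x, y, z, w}"
    using ex_fresh[OF V, of "[x, y, z, w]"] by auto
  have no_tri: "col {x, z} = col {x, y} \<or> col {x, z} = col {y, z}"
    using xyz w w' no[of x y z w] no[of x z y w] no[of y x z w] no[of y z x w] no[of z x y w]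
      no[of z y x w] no[of x y z w'] no[of x z y w'] no[of y x z w'] no[of y z x w'] no[of z x y w']
      no[of z y x w'] no[of w x y w']
    by (simp add: insert_commute) (smt (verit))
  obtain u v where uv: "u \<in> V" "v \<in> V" "u \<noteq> v" "col {u, v} \<noteq> col {x, y}" "col {u, v} \<noteq> col {y, z}"
    using many by blast
  have out: "col {x, v} \<in> {col {x, y}, col {y, z}}" "col {z, v} \<in> {col {x, y}, col {y, z}}"
    if "v \<in> V" "v \<notin> {x, y, z}" for v
    using xyz that no[of v x y z] no[of x y z v] by (auto simp: insert_commute)
  have mid: "col {y, v} \<in> {col {x, y}, col {y, z}}" if "v \<in> V" "v \<notin> {x, y, z}" for v
    using xyz that out[OF that] no[of x v y z] no[of z v y x] no[of x z v y] no[of z x v y]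
      no[of v y x z] no[of v y z x] no_tri no[of x v z y] 
    by (simp add: insert_commute) (smt (verit))
  have inside: "col {a, b} \<in> {col {x, y}, col {y, z}}" if "a \<in> {x, y, z}" "b \<in> V" "a \<noteq> b" for a b
  proof (cases "b \<in> {x, y, z}")
    case True
    then show ?thesis using that no_tri by (auto simp: insert_commute)
  next
    case False
    then show ?thesis using that out[of b] mid[of b] by blast
  qed
  have "u \<notin> {x, y, z} \<and> v \<notin> {x, y, z}"
    using uv inside[of u v] inside[of v u] by (auto simp: insert_commute)
  then show False
    using xyz uv out[of u] out[of v] no[of v u x y] no[of v u z y] no[of x u v z]
      no[of u v x y] no[of u v z y]
    by (simp add: insert_commute) (smt (verit))
qed

theorem dominant_or_almost_mono:
  assumes V: "card V \<ge> 6"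
    and many: "\<And>\<alpha> \<beta> \<gamma>. \<exists>x\<in>V. \<exists>y\<in>V. x \<noteq> y \<and> col {x, y} \<notin> {\<alpha>, \<beta>, \<gamma>}"
  shows "\<exists>k. dominant k \<or> almost_mono k"
proof -
  have paw: ?thesis if "rainbow_paw p q r s" for p q r s
  proof -
    obtain w where w: "w \<in> V" "w \<notin> {p, q, r, s}"
      using ex_fresh[OF V, of "[p, q, r, s]"] by auto
    have "distinct [p, q, r, s, w]" "{p, q, r, s, w} \<subseteq> V"
      "distinct [col {p, q}, col {q, r}, col {p, r}, col {r, s}]"
      using that w by (auto simp: rainbow_paw_def)
    from paw_core[OF this] show ?thesis
      using tri_core_almost_mono[OF _ V] star_core_almost_mono by blast
  qed
  have "\<exists>x\<in>V. \<exists>y\<in>V. x \<noteq> y \<and> col {x, y} \<notin> {\<alpha>, \<beta>}" for \<alpha> \<beta>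
    using many[of \<alpha> \<beta> \<beta>] by auto
  then obtain p q r s where P: "distinct [p, q, r, s]" "{p, q, r, s} \<subseteq> V"
    "distinct [col {p, q}, col {q, r}, col {r, s}]"
    using rainbow_P4_exists[OF V] by metis
  obtain x y where xy: "x \<in> V" "y \<in> V" "x \<noteq> y" "col {x, y} \<notin> {col {p, q}, col {q, r}, col {r, s}}"
    using many[of "col {p, q}" "col {q, r}" "col {r, s}"] by blast
  have touch: ?thesis if "x \<in> {p, q, r, s}" "y \<in> V" "x \<noteq> y"
      "col {x, y} \<notin> {col {p, q}, col {q, r}, col {r, s}}" for x y
  proof (cases "y \<in> {p, q, r, s}")
    case True
    with that(1,3,4) have "col {p, r} \<notin> {col {p, q}, col {q, r}, col {r, s}} \<or>
        col {q, s} \<notin> {col {p, q}, col {q, r}, col {r, s}} \<or>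
        col {p, s} \<notin> {col {p, q}, col {q, r}, col {r, s}}"
      by (elim insertE emptyE) (simp_all add: insert_commute)
    then have "rainbow_paw p q r s \<or> rainbow_paw s r q p \<or>
        distinct [col {p, q}, col {q, r}, col {r, s}, col {p, s}]"
      using P unfolding rainbow_paw_def by (simp add: insert_commute) metis
    then show ?thesis using paw C4_paw[OF P(1,2)] by blast
  next
    case False
    have "x \<noteq> p" "x \<noteq> s"
      using path[of y p q r s] path[of p q r s y] that False P by (auto simp: insert_commute)
    with that(1) consider "x = q" | "x = r" by blast
    then have "\<exists>p q r s. rainbow_paw p q r s"
    proof cases
      case 1
      then show ?thesis using chair_paw[of p q r s y] that False P by auto
    next
      case 2
      then show ?thesis using chair_paw[of s r q p y] that False P by (auto simp: insert_commute)
    qed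
    then show ?thesis using paw by blast
  qed
  show ?thesis
  proof (cases "x \<in> {p, q, r, s} \<or> y \<in> {p, q, r, s}")
    case True
    then show ?thesis using touch[of x y] touch[of y x] xy by (auto simp: insert_commute)
  next
    case False
    then have "dom_core (col {q, r}) p q r s x y"
      using disjoint_edge_dom_core[of p q r s x y] P xy by auto
    then show ?thesis using dom_core_dominant by blast
  qed
qed

lemma K5_incident_same_color:
  assumes "distinct [a, b, c, d, e]" "{a, b, c, d, e} \<subseteq> V"
  obtains x y z where "{x, y, z} \<subseteq> V" "distinct [x, y, z]" "col {x, y} = col {x, z}"
proof (rule ccontr)
  note found = that
  assume "\<not> thesis"
  then have proper: "col {x, y} \<noteq> col {x, z}" if "{x, y, z} \<subseteq> V" "distinct [x, y, z]" for x y z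
    using that found by blast
  show False
    using assms path[of a b e c d] path[of a e b d c] path[of a b e d c] path[of b a c e d]
      path[of d a c b e] path[of a e d c b]
      proper[of a b c] proper[of a b d] proper[of a b e] proper[of a c d] proper[of a c e] proper[of a d e]
      proper[of b a c] proper[of b a d] proper[of b a e] proper[of b c d] proper[of b c e] proper[of b d e]
      proper[of c a b] proper[of c a d] proper[of c a e] proper[of c b d] proper[of c b e] proper[of c d e]
      proper[of d a b] proper[of d a c] proper[of d a e] proper[of d b c] proper[of d b e] proper[of d c e]
      proper[of e a b] proper[of e a c] proper[of e a d] proper[of e b c] proper[of e b d] proper[of e c d]
    by (simp add: insert_commute) (smt (verit))
qed

end

section \<open>Monochromatic copies, Ramsey numbers and colorings\<close>

lemma complete_graph_simps [simp]:
  "verts (complete_graph n) = {..<n}" "edges (complete_graph n) = nsets {..<n} 2"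
  by (simp_all add: complete_graph_def)

lemma fin_graph_edgeE:
  assumes "fin_graph G" "e \<in> edges G"
  obtains x y where "e = {x, y}" "x \<in> verts G" "y \<in> verts G" "x \<noteq> y"
  using assms by (meson fin_graph_def nsets2_E subsetD)

lemma fin_graph_edgeD:
  assumes "fin_graph G" "{x, y} \<in> edges G"
  shows "x \<in> verts G" "y \<in> verts G" "x \<noteq> y"
proof -
  have "{x, y} \<in> nsets (verts G) 2" using assms unfolding fin_graph_def by blast
  then show "x \<in> verts G" "y \<in> verts G" "x \<noteq> y" by simp_all
qed

lemma connected_graphD:
  assumes "connected_graph G"
  shows "fin_graph G" "finite (verts G)" "card (verts G) > 0"
  using assms by (auto simp: connected_graph_def fin_graph_def card_gt_0_iff)

lemma has_mono_copy_iff: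
  assumes "fin_graph H"
  shows "has_mono_copy n col H \<longleftrightarrow> (\<exists>\<phi>. inj_on \<phi> (verts H) \<and> \<phi> ` verts H \<subseteq> {..<n} \<and>
    (\<forall>e\<in>edges H. \<forall>e'\<in>edges H. col (\<phi> ` e) = col (\<phi> ` e')))"
proof -
  have "\<phi> ` e \<in> nsets {..<n} 2" if "inj_on \<phi> (verts H)" "\<phi> ` verts H \<subseteq> {..<n}" and e: "e \<in> edges H" for \<phi> e
  proof -
    obtain x y where "e = {x, y}" "x \<in> verts H" "y \<in> verts H" "x \<noteq> y"
      using assms e by (rule fin_graph_edgeE)
    with that show ?thesis by (auto simp: inj_on_def)
  qed
  then show ?thesis unfolding has_mono_copy_def embedding_def by auto
qed

lemma has_mono_copyI:
  assumes "fin_graph H" "inj_on \<phi> (verts H)" "\<phi> ` verts H \<subseteq> {..<n}"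
    "\<And>e. e \<in> edges H \<Longrightarrow> col (\<phi> ` e) = k"
  shows "has_mono_copy n col H"
  using assms by (auto simp: has_mono_copy_iff)

lemma has_mono_copyE:
  assumes "fin_graph H" "has_mono_copy n col H"
  obtains \<phi> k where "inj_on \<phi> (verts H)" "\<phi> ` verts H \<subseteq> {..<n}"
    "\<And>e. e \<in> edges H \<Longrightarrow> col (\<phi> ` e) = k"
  using assms by (metis (no_types, lifting) has_mono_copy_iff)

lemma has_mono_copy_mono:
  assumes "has_mono_copy m col H" "m \<le> n"
  shows "has_mono_copy n col H"
proof -
  obtain \<phi> where \<phi>: "embedding \<phi> H (complete_graph m)"
    "\<forall>e\<in>edges H. \<forall>e'\<in>edges H. col (\<phi> ` e) = col (\<phi> ` e')"
    using assms(1) by (auto simp: has_mono_copy_def)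
  have "nsets {..<m} 2 \<subseteq> nsets {..<n} 2" by (intro nsets_mono) (use assms(2) in auto)
  with \<phi> assms(2) have "embedding \<phi> H (complete_graph n)"
    by (fastforce simp: embedding_def)
  with \<phi>(2) show ?thesis by (auto simp: has_mono_copy_def)
qed

lemma ramsey_number_exists:
  assumes H: "fin_graph H"
  shows "\<exists>n. \<forall>col \<in> edges (complete_graph n) \<rightarrow> {1..k}. has_mono_copy n col H"
proof -
  define m where "m = card (verts H)"
  obtain N :: nat where N: "partn_lst {..<N} (replicate k m) 2"
    using ramsey_full by blast
  have "has_mono_copy N col H" if col: "col \<in> nsets {..<N} 2 \<rightarrow> {1..k}" for col
  proof -
    have "(\<lambda>e. col e - 1) \<in> nsets {..<N} 2 \<rightarrow> {..<length (replicate k m)}"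
      using col by (fastforce simp: Pi_iff)
    with N obtain i M where "i < k" and M: "M \<in> nsets {..<N} m" and i: "(\<lambda>e. col e - 1) ` nsets M 2 \<subseteq> {i}"
      unfolding partn_lst_def monochromatic_def by fastforce
    have M': "M \<subseteq> {..<N}" "finite M" "card M = m" using M by (auto simp: nsets_def)
    then obtain \<phi> where \<phi>: "bij_betw \<phi> (verts H) M"
      using finite_same_card_bij[of "verts H" M] H by (auto simp: fin_graph_def m_def)
    show ?thesis
    proof (rule has_mono_copyI[OF H])
      show "inj_on \<phi> (verts H)" "\<phi> ` verts H \<subseteq> {..<N}"
        using \<phi> M' by (auto simp: bij_betw_def)
      fix e assume "e \<in> edges H"
      with H obtain x y where xy: "e = {x, y}" "x \<in> verts H" "y \<in> verts H" "x \<noteq> y"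
        by (rule fin_graph_edgeE)
      then have e: "\<phi> ` e \<in> nsets M 2" using \<phi> by (auto simp: bij_betw_def inj_on_def)
      then have "\<phi> ` e \<in> nsets {..<N} 2" using M' nsets_mono by blast
      then have "col (\<phi> ` e) \<ge> 1" using col by (auto simp: Pi_iff)
      moreover have "col (\<phi> ` e) - 1 = i" using i e by blast
      ultimately show "col (\<phi> ` e) = Suc i" by simp
    qed
  qed
  then show ?thesis by auto
qed

lemma ramsey_number_mono_copy:
  assumes H: "fin_graph H" and col: "col \<in> nsets {..<n} 2 \<rightarrow> {1..k}" and n: "ramsey_number k H \<le> n"
  shows "has_mono_copy n col H"
proof -
  have "\<forall>col \<in> edges (complete_graph (ramsey_number k H)) \<rightarrow> {1..k}. has_mono_copy (ramsey_number k H) col H"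
    unfolding ramsey_number_def by (rule LeastI_ex[OF ramsey_number_exists[OF H]])
  moreover have "col \<in> nsets {..<ramsey_number k H} 2 \<rightarrow> {1..k}"
    using col n nsets_mono[of "{..<ramsey_number k H}" "{..<n}" 2] by (auto simp: Pi_iff)
  ultimately show ?thesis using n by (auto intro: has_mono_copy_mono)
qed

lemma less_ramsey_number:
  assumes "m < ramsey_number k H"
  obtains col where "col \<in> nsets {..<m} 2 \<rightarrow> {1..k}" "\<not> has_mono_copy m col H"
  using not_less_Least[OF assms[unfolded ramsey_number_def]] by auto

lemma card_verts_le_ramsey_number:
  assumes H: "fin_graph H" and k: "k \<ge> 1"
  shows "card (verts H) \<le> ramsey_number k H"
proof -
  have "has_mono_copy (ramsey_number k H) (\<lambda>_. 1) H"
    by (rule ramsey_number_mono_copy[OF H, where k = k]) (use k in auto)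
  then obtain \<phi> where "inj_on \<phi> (verts H)" "\<phi> ` verts H \<subseteq> {..<ramsey_number k H}"
    using has_mono_copyE[OF H] by metis
  then show ?thesis using card_inj_on_le[of \<phi> "verts H" "{..<ramsey_number k H}"] by simp
qed

lemma ramsey_number_2_subset:
  assumes G: "fin_graph G" and U: "finite U" "card U \<ge> ramsey_number 2 G"
  obtains \<phi> where "inj_on \<phi> (verts G)" "\<phi> ` verts G \<subseteq> U"
    "(\<forall>e\<in>edges G. P (\<phi> ` e)) \<or> (\<forall>e\<in>edges G. \<not> P (\<phi> ` e))"
proof -
  obtain f where f: "bij_betw f {..<card U} U"
    using U(1) ex_bij_betw_nat_finite[of U] by (auto simp: atLeast0LessThan)
  define col where "col = (\<lambda>e. if P (f ` e) then 1 else (2::nat))"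
  have "has_mono_copy (card U) col G"
    by (rule ramsey_number_mono_copy[OF G _ U(2)]) (auto simp: col_def)
  then obtain \<psi> k where \<psi>: "inj_on \<psi> (verts G)" "\<psi> ` verts G \<subseteq> {..<card U}"
    "\<And>e. e \<in> edges G \<Longrightarrow> col (\<psi> ` e) = k"
    using has_mono_copyE[OF G] by metis
  show thesis
  proof (rule that[of "f \<circ> \<psi>"])
    show "inj_on (f \<circ> \<psi>) (verts G)" "(f \<circ> \<psi>) ` verts G \<subseteq> U"
      using \<psi> f by (auto simp: bij_betw_def intro!: comp_inj_on intro: inj_on_subset)
    show "(\<forall>e\<in>edges G. P ((f \<circ> \<psi>) ` e)) \<or> (\<forall>e\<in>edges G. \<not> P ((f \<circ> \<psi>) ` e))"
      using \<psi>(3) unfolding col_def image_comp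
      by (metis numeral_One numeral_eq_iff semiring_norm(85))
  qed
qed

lemma connected_graph_label_const:
  assumes G: "connected_graph G" and L: "\<And>x y. {x, y} \<in> edges G \<Longrightarrow> L x = L y"
    and uv: "u \<in> verts G" "v \<in> verts G"
  shows "L u = L v"
proof -
  have "(u, v) \<in> {(x, y). {x, y} \<in> edges G}\<^sup>*" using G uv by (auto simp: connected_graph_def)
  then show ?thesis by (induction rule: rtrancl_induct) (use L in auto)
qed

lemma connected_graph_neighbour:
  assumes G: "connected_graph G" and "card (verts G) \<ge> 2" and u: "u \<in> verts G"
  obtains v where "{u, v} \<in> edges G"
proof -
  have "\<not> verts G \<subseteq> {u}" using assms(2) by (metis card.empty card_1_singleton_iff card_mono
      finite.emptyI finite_insert is_singletonI is_singleton_altdef not_less_eq_eq numeral_2_eq_2 One_nat_def)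
  then obtain w where w: "w \<in> verts G" "w \<noteq> u" by blast
  have "(u, w) \<in> {(x, y). {x, y} \<in> edges G}\<^sup>*" using G u w by (auto simp: connected_graph_def)
  then show thesis using w(2) that by (cases rule: converse_rtranclE) auto
qed

lemma proper_coloringD:
  assumes "c \<in> proper_colorings G k"
  shows "v \<in> verts G \<Longrightarrow> c v < k" "{u, v} \<in> edges G \<Longrightarrow> c u \<noteq> c v"
  using assms by (auto simp: proper_colorings_def Pi_iff)

lemma proper_colorings_card:
  assumes G: "fin_graph G"
  shows "proper_colorings G (card (verts G)) \<noteq> {}"
proof -
  obtain f where f: "bij_betw f (verts G) {..<card (verts G)}"
    using G ex_bij_betw_finite_nat[of "verts G"] by (auto simp: atLeast0LessThan fin_graph_def)
  have "f u \<noteq> f v" if "{u, v} \<in> edges G" for u v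
    using f fin_graph_edgeD[OF G that] by (auto simp: bij_betw_def inj_on_def)
  with f have "f \<in> proper_colorings G (card (verts G))"
    by (auto simp: proper_colorings_def bij_betw_def)
  then show ?thesis by blast
qed

lemma chromatic_number_proper:
  assumes "fin_graph G"
  shows "proper_colorings G (chromatic_number G) \<noteq> {}"
  unfolding chromatic_number_def by (rule LeastI_ex) (use proper_colorings_card[OF assms] in blast)

lemma chromatic_number_le:
  assumes "c \<in> proper_colorings G k"
  shows "chromatic_number G \<le> k"
  unfolding chromatic_number_def by (rule Least_le) (use assms in blast)

lemma chromatic_number_le_card: "fin_graph G \<Longrightarrow> chromatic_number G \<le> card (verts G)"
  using proper_colorings_card chromatic_number_le by blast

lemma chromatic_number_ge2:
  assumes G: "connected_graph G" and "card (verts G) \<ge> 2"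
  shows "chromatic_number G \<ge> 2"
proof -
  obtain c where c: "c \<in> proper_colorings G (chromatic_number G)"
    using chromatic_number_proper connected_graphD(1)[OF G] by blast
  obtain u where u: "u \<in> verts G" using connected_graphD(3)[OF G] by (auto simp: card_gt_0_iff)
  then obtain v where uv: "{u, v} \<in> edges G" using connected_graph_neighbour assms by metis
  then have "v \<in> verts G" using fin_graph_edgeD[OF connected_graphD(1)[OF G]] by blast
  then have "c u < chromatic_number G" "c v < chromatic_number G" "c u \<noteq> c v"
    using proper_coloringD[OF c] u uv by blast+
  then show ?thesis by linarith
qed

lemma chromatic_surplus_le:
  assumes c: "c \<in> proper_colorings G (chromatic_number G)" and i: "i < chromatic_number G"
  shows "chromatic_surplus G \<le> card {v \<in> verts G. c v = i}"
proof -
  have "chromatic_surplus G \<le> (MIN i\<in>{..<chromatic_number G}. card {v \<in> verts G. c v = i})"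
    unfolding chromatic_surplus_def by (rule cINF_lower[OF _ c]) simp
  also have "\<dots> \<le> card {v \<in> verts G. c v = i}"
    by (rule Min_le) (use i in auto)
  finally show ?thesis .
qed

lemma chromatic_number_times_surplus_le:
  assumes G: "fin_graph G"
  shows "chromatic_number G * chromatic_surplus G \<le> card (verts G)"
proof -
  let ?k = "chromatic_number G"
  obtain c where c: "c \<in> proper_colorings G ?k" using chromatic_number_proper[OF G] by blast
  have fin: "finite (verts G)" using G by (simp add: fin_graph_def)
  have "?k * chromatic_surplus G = (\<Sum>i<?k. chromatic_surplus G)" by simp
  also have "\<dots> \<le> (\<Sum>i<?k. card {v \<in> verts G. c v = i})"
    by (intro sum_mono chromatic_surplus_le[OF c]) simp
  also have "\<dots> = card (\<Union>i<?k. {v \<in> verts G. c v = i})"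
    by (rule card_UN_disjoint[symmetric]) (use fin in auto)
  also have "\<dots> \<le> card (verts G)" by (rule card_mono[OF fin]) auto
  finally show ?thesis .
qed

section \<open>Disjoint copies and disjoint unions\<close>

definition copies :: "'a sgraph \<Rightarrow> 'b set \<Rightarrow> 'i set \<Rightarrow> ('i \<Rightarrow> 'a \<Rightarrow> 'b) \<Rightarrow> bool" where
  "copies G U I \<Phi> \<longleftrightarrow> (\<forall>i\<in>I. inj_on (\<Phi> i) (verts G) \<and> \<Phi> i ` verts G \<subseteq> U) \<and>
     (\<forall>i\<in>I. \<forall>j\<in>I. i \<noteq> j \<longrightarrow> \<Phi> i ` verts G \<inter> \<Phi> j ` verts G = {})"

lemma copies_mono: "copies G U I \<Phi> \<Longrightarrow> U \<subseteq> W \<Longrightarrow> copies G W I \<Phi>"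
  unfolding copies_def by (meson order_trans)

lemma copies_insert:
  assumes "copies G U I \<Phi>" "inj_on \<phi> (verts G)" "\<phi> ` verts G \<subseteq> U" "i \<notin> I"
    "\<And>j. j \<in> I \<Longrightarrow> \<phi> ` verts G \<inter> \<Phi> j ` verts G = {}"
  shows "copies G U (insert i I) (\<Phi>(i := \<phi>))"
proof -
  have "\<Phi> j ` verts G \<inter> \<phi> ` verts G = {}" if "j \<in> I" for j using assms(5)[OF that] by blast
  moreover have "j \<noteq> i" if "j \<in> I" for j using that assms(4) by blast
  ultimately show ?thesis using assms unfolding copies_def by simp
qed

lemma copies_greedy:
  assumes "finite U" "card U \<ge> R + m * card (verts G)" and fin: "finite (verts G)"
    and ex: "\<And>W. W \<subseteq> U \<Longrightarrow> card W \<ge> R \<Longrightarrow> \<exists>\<phi>. inj_on \<phi> (verts G) \<and> \<phi> ` verts G \<subseteq> W \<and> Q \<phi>"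
  shows "\<exists>\<Phi>. copies G U {..<Suc m} \<Phi> \<and> (\<forall>i<Suc m. Q (\<Phi> i))"
  using assms(1,2,4)
proof (induction m arbitrary: U)
  case 0
  then obtain \<phi> where "inj_on \<phi> (verts G) \<and> \<phi> ` verts G \<subseteq> U \<and> Q \<phi>" by force
  then show ?case by (intro exI[of _ "\<lambda>_. \<phi>"]) (auto simp: copies_def)
next
  case (Suc m)
  then obtain \<phi> where \<phi>: "inj_on \<phi> (verts G)" "\<phi> ` verts G \<subseteq> U" "Q \<phi>" by force
  let ?U = "U - \<phi> ` verts G"
  have "card ?U = card U - card (verts G)"
    using \<phi> fin by (simp add: card_Diff_subset card_image)
  then have "card ?U \<ge> R + m * card (verts G)" using Suc.prems(2) by simp
  moreover have "\<exists>\<phi>. inj_on \<phi> (verts G) \<and> \<phi> ` verts G \<subseteq> W \<and> Q \<phi>" if "W \<subseteq> ?U" "card W \<ge> R" for W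
    using Suc.prems(3)[of W] that by blast
  moreover have "finite ?U" using Suc.prems(1) by simp
  ultimately obtain \<Phi> where \<Phi>: "copies G ?U {..<Suc m} \<Phi>" "\<forall>i<Suc m. Q (\<Phi> i)"
    using Suc.IH[of ?U] by blast
  then have "copies G U {..<Suc m} \<Phi>" by (meson Diff_subset copies_mono)
  moreover have "\<phi> ` verts G \<inter> \<Phi> j ` verts G = {}" if "j \<in> {..<Suc m}" for j
  proof -
    have "\<Phi> j ` verts G \<subseteq> ?U" using \<Phi>(1) that unfolding copies_def by blast
    then show ?thesis by blast
  qed
  ultimately have "copies G U (insert (Suc m) {..<Suc m}) (\<Phi>(Suc m := \<phi>))"
    using \<phi> by (intro copies_insert) auto
  then have "copies G U {..<Suc (Suc m)} (\<Phi>(Suc m := \<phi>))" by (simp only: lessThan_Suc)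
  moreover have "\<forall>i<Suc (Suc m). Q ((\<Phi>(Suc m := \<phi>)) i)" using \<Phi>(2) \<phi>(3) by (auto simp: less_Suc_eq)
  ultimately show ?case by blast
qed

lemma disjoint_union_simps:
  "verts (disjoint_union Gs) = (SIGMA i:{..<length Gs}. verts (Gs ! i))"
  "edges (disjoint_union Gs) = (\<Union>i<length Gs. (\<lambda>e. Pair i ` e) ` edges (Gs ! i))"
  by (simp_all add: disjoint_union_def)

lemma fin_graph_disjoint_union:
  assumes "\<And>i. i < length Gs \<Longrightarrow> fin_graph (Gs ! i)"
  shows "fin_graph (disjoint_union Gs)"
  unfolding fin_graph_def
proof
  show "finite (verts (disjoint_union Gs))"
    using assms by (auto simp: disjoint_union_simps fin_graph_def)
  show "edges (disjoint_union Gs) \<subseteq> nsets (verts (disjoint_union Gs)) 2"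
  proof
    fix e assume "e \<in> edges (disjoint_union Gs)"
    then obtain i e' where i: "i < length Gs" and e': "e' \<in> edges (Gs ! i)" "e = Pair i ` e'"
      by (auto simp: disjoint_union_simps)
    obtain x y where "e' = {x, y}" "x \<in> verts (Gs ! i)" "y \<in> verts (Gs ! i)" "x \<noteq> y"
      using assms[OF i] e'(1) by (rule fin_graph_edgeE)
    with i e' show "e \<in> nsets (verts (disjoint_union Gs)) 2"
      by (simp add: disjoint_union_simps)
  qed
qed

lemma has_mono_copy_component:
  assumes "has_mono_copy n col (disjoint_union Gs)" "i < length Gs"
  shows "has_mono_copy n col (Gs ! i)"
proof -
  obtain \<phi> where \<phi>: "embedding \<phi> (disjoint_union Gs) (complete_graph n)"
    "\<forall>e\<in>edges (disjoint_union Gs). \<forall>e'\<in>edges (disjoint_union Gs). col (\<phi> ` e) = col (\<phi> ` e')"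
    using assms(1) by (auto simp: has_mono_copy_def)
  have e: "Pair i ` e \<in> edges (disjoint_union Gs)" if "e \<in> edges (Gs ! i)" for e
    using that assms(2) by (auto simp: disjoint_union_simps)
  have v: "(i, v) \<in> verts (disjoint_union Gs)" if "v \<in> verts (Gs ! i)" for v
    using that assms(2) by (auto simp: disjoint_union_simps)
  have "inj_on (\<phi> \<circ> Pair i) (verts (Gs ! i))"
  proof (rule inj_onI)
    fix x y assume "x \<in> verts (Gs ! i)" "y \<in> verts (Gs ! i)" "(\<phi> \<circ> Pair i) x = (\<phi> \<circ> Pair i) y"
    then have "(i, x) = (i, y)" using \<phi>(1) v unfolding embedding_def by (auto dest: inj_onD)
    then show "x = y" by simp
  qed
  then have "embedding (\<phi> \<circ> Pair i) (Gs ! i) (complete_graph n)"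
    using \<phi>(1) e v unfolding embedding_def image_comp[symmetric]
    by (auto simp: image_subset_iff)
  moreover have "col ((\<phi> \<circ> Pair i) ` e) = col ((\<phi> \<circ> Pair i) ` e')"
    if "e \<in> edges (Gs ! i)" "e' \<in> edges (Gs ! i)" for e e'
    using \<phi>(2) e[OF that(1)] e[OF that(2)] unfolding image_comp[symmetric] by blast
  ultimately show ?thesis unfolding has_mono_copy_def by blast
qed

lemma has_mono_copy_disjoint_union:
  assumes fin: "\<And>i. i < length Gs \<Longrightarrow> fin_graph (Gs ! i)"
    and sub: "\<And>i. i < length Gs \<Longrightarrow> is_subgraph (Gs ! i) G"
    and \<Phi>: "copies G {..<n} {..<length Gs} \<Phi>"
    and mono: "\<And>i e. i < length Gs \<Longrightarrow> e \<in> edges G \<Longrightarrow> col (\<Phi> i ` e) = k"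
  shows "has_mono_copy n col (disjoint_union Gs)"
proof -
  obtain \<psi> where \<psi>: "\<And>i. i < length Gs \<Longrightarrow> embedding (\<psi> i) (Gs ! i) G"
    using sub unfolding is_subgraph_def by metis
  define \<phi> where "\<phi> = (\<lambda>(i, v). \<Phi> i (\<psi> i v))"
  have \<psi>V: "\<psi> i v \<in> verts G" if "i < length Gs" "v \<in> verts (Gs ! i)" for i v
    using \<psi>[OF that(1)] that(2) by (auto simp: embedding_def)
  show ?thesis
  proof (rule has_mono_copyI[OF fin_graph_disjoint_union[OF fin]])
    show "inj_on \<phi> (verts (disjoint_union Gs))"
    proof (rule inj_onI)
      fix p q assume pq: "p \<in> verts (disjoint_union Gs)" "q \<in> verts (disjoint_union Gs)" "\<phi> p = \<phi> q"
      obtain i v j w where p: "p = (i, v)" "i < length Gs" "v \<in> verts (Gs ! i)"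
        and q: "q = (j, w)" "j < length Gs" "w \<in> verts (Gs ! j)"
        using pq(1,2) by (auto simp: disjoint_union_simps)
      have eq: "\<Phi> i (\<psi> i v) = \<Phi> j (\<psi> j w)" using pq(3) p q by (simp add: \<phi>_def)
      have "i = j"
      proof (rule ccontr)
        assume "i \<noteq> j"
        then have "\<Phi> i ` verts G \<inter> \<Phi> j ` verts G = {}"
          using \<Phi> p q by (simp add: copies_def)
        then show False using eq \<psi>V p q by blast
      qed
      with eq have "\<psi> i v = \<psi> i w"
        using \<Phi> p q \<psi>V by (auto simp: copies_def inj_on_def)
      then show "p = q" using \<psi>[OF p(2)] p q \<open>i = j\<close> by (auto simp: embedding_def inj_on_def)
    qed
    show "\<phi> ` verts (disjoint_union Gs) \<subseteq> {..<n}"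
      using \<Phi> \<psi>V by (fastforce simp: disjoint_union_simps \<phi>_def copies_def)
    fix e assume "e \<in> edges (disjoint_union Gs)"
    then obtain i e' where i: "i < length Gs" and e': "e' \<in> edges (Gs ! i)" "e = Pair i ` e'"
      by (auto simp: disjoint_union_simps)
    have "\<phi> ` e = \<Phi> i ` (\<psi> i ` e')" by (auto simp: e'(2) \<phi>_def image_image)
    moreover have "\<psi> i ` e' \<in> edges G" using \<psi>[OF i] e'(1) by (auto simp: embedding_def)
    ultimately show "col (\<phi> ` e) = k" using mono[OF i] by simp
  qed (auto)
qed

section \<open>Lower bounds\<close>

text \<open>
  Color each edge by a labelling on which its ends agree. A connected monochromatic graph then lies
  in a single label class.
\<close>

lemma label_lower_bound:
  assumes G: "connected_graph G"
    and agree: "\<And>x y. x < m \<Longrightarrow> y < m \<Longrightarrow> x \<noteq> y \<Longrightarrow> L1 x = L1 y \<or> L2 x = L2 y \<or> L3 x = L3 y"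
    and small: "\<And>L l. L \<in> {L1, L2, L3} \<Longrightarrow> card {x. x < m \<and> L x = l} < card (verts G)"
  obtains col where "col \<in> nsets {..<m} 2 \<rightarrow> {1..3}" "\<not> has_mono_copy m col G"
proof -
  define col where "col = (\<lambda>e. if card (L1 ` e) = 1 then 1 else if card (L2 ` e) = 1 then 2 else (3::nat))"
  have two: "card (f ` {x, y}) = 1 \<longleftrightarrow> f x = f y" for f :: "nat \<Rightarrow> 'b" and x y
    by (auto simp: card_insert_if)
  have "\<not> has_mono_copy m col G"
  proof
    assume "has_mono_copy m col G"
    then obtain \<phi> k where \<phi>: "inj_on \<phi> (verts G)" "\<phi> ` verts G \<subseteq> {..<m}"
      "\<And>e. e \<in> edges G \<Longrightarrow> col (\<phi> ` e) = k"
      using has_mono_copyE[OF connected_graphD(1)[OF G]] by metis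
    obtain L where L: "L \<in> {L1, L2, L3}"
      and Lk: "\<And>x y. x < m \<Longrightarrow> y < m \<Longrightarrow> x \<noteq> y \<Longrightarrow> col {x, y} = k \<Longrightarrow> L x = L y"
    proof
      let ?L = "if k = 1 then L1 else if k = 2 then L2 else L3"
      show "?L \<in> {L1, L2, L3}" by simp
      fix x y assume "x < m" "y < m" "x \<noteq> y" "col {x, y} = k"
      then show "?L x = ?L y"
        using agree[of x y] two[of L1 x y] two[of L2 x y] unfolding col_def
        by (auto split: if_splits)
    qed
    have edge: "L (\<phi> x) = L (\<phi> y)" if "{x, y} \<in> edges G" for x y
    proof (rule Lk)
      note xy = fin_graph_edgeD[OF connected_graphD(1)[OF G] that]
      show "\<phi> x < m" "\<phi> y < m" using \<phi>(2) xy by auto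
      show "\<phi> x \<noteq> \<phi> y" using \<phi>(1) xy by (auto dest: inj_onD)
      show "col {\<phi> x, \<phi> y} = k" using \<phi>(3)[OF that] by simp
    qed
    obtain u where u: "u \<in> verts G" using connected_graphD(3)[OF G] by (auto simp: card_gt_0_iff)
    have "L (\<phi> v) = L (\<phi> u)" if "v \<in> verts G" for v
      by (rule connected_graph_label_const[OF G _ that u, of "\<lambda>x. L (\<phi> x)"]) (rule edge)
    then have "\<phi> ` verts G \<subseteq> {x. x < m \<and> L x = L (\<phi> u)}" using \<phi>(2) by auto
    then have "card (\<phi> ` verts G) \<le> card {x. x < m \<and> L x = L (\<phi> u)}"
      by (intro card_mono) auto
    then show False using small[OF L, of "L (\<phi> u)"] by (simp add: card_image[OF \<phi>(1)])
  qed
  moreover have "col \<in> nsets {..<m} 2 \<rightarrow> {1..3}" by (auto simp: col_def)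
  ultimately show thesis using that by blast
qed

lemma card_le_length: "S \<subseteq> set xs \<Longrightarrow> card S \<le> length xs"
  by (meson List.finite_set card_length card_mono le_trans)

lemma K4_lower_bound:
  assumes G: "connected_graph G" "card (verts G) \<ge> 3"
  obtains col where "col \<in> nsets {..<4} 2 \<rightarrow> {1..3}" "\<not> has_mono_copy 4 col G"
proof (rule label_lower_bound[OF G(1), of 4 "\<lambda>x. x div 2" "\<lambda>x. x mod 2" "\<lambda>x. if x = 1 \<or> x = 2 then 1 else 0"])
  have less4: "x < 4 \<longleftrightarrow> x = 0 \<or> x = 1 \<or> x = 2 \<or> x = 3" for x :: nat by linarith
  fix x y :: nat assume "x < 4" "y < 4" "x \<noteq> y"
  then show "x div 2 = y div 2 \<or> x mod 2 = y mod 2 \<or>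
      (if x = 1 \<or> x = 2 then 1 else 0) = (if y = 1 \<or> y = 2 then 1 else (0::nat))"
    unfolding less4 by auto
next
  fix L :: "nat \<Rightarrow> nat" and l
  assume L: "L \<in> {\<lambda>x. x div 2, \<lambda>x. x mod 2, \<lambda>x. if x = 1 \<or> x = 2 then 1 else 0}"
  have less4: "x < 4 \<longleftrightarrow> x = 0 \<or> x = 1 \<or> x = 2 \<or> x = 3" for x :: nat by linarith
  have "{x. x < 4 \<and> L x = l} \<subseteq> set [2 * l, 2 * l + 1] \<or> {x. x < 4 \<and> L x = l} \<subseteq> set [l, l + 2]
      \<or> {x. x < 4 \<and> L x = l} \<subseteq> set [1, 2] \<or> {x. x < 4 \<and> L x = l} \<subseteq> set [0, 3]"
    using L unfolding less4 by (cases "l = 0") auto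
  then have "card {x. x < 4 \<and> L x = l} \<le> 2"
    by (elim disjE) (drule card_le_length, simp)+
  then show "card {x. x < 4 \<and> L x = l} < card (verts G)" using G(2) by simp
qed (rule that)

lemma K5_lower_bound:
  assumes G: "connected_graph G" "card (verts G) \<ge> 4"
  obtains col where "col \<in> nsets {..<5} 2 \<rightarrow> {1..3}" "\<not> has_mono_copy 5 col G"
proof (rule label_lower_bound[OF G(1), of 5 "\<lambda>x. if x = 3 \<or> x = 4 then 1 else 0"
      "\<lambda>x. if x = 2 \<or> x = 4 then 1 else 0" "\<lambda>x. if x = 2 \<or> x = 3 then 1 else 0"])
  have less5: "x < 5 \<longleftrightarrow> x = 0 \<or> x = 1 \<or> x = 2 \<or> x = 3 \<or> x = 4" for x :: nat by linarith
  fix x y :: nat assume "x < 5" "y < 5" "x \<noteq> y"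
  then show "(if x = 3 \<or> x = 4 then 1 else 0) = (if y = 3 \<or> y = 4 then 1 else (0::nat)) \<or>
      (if x = 2 \<or> x = 4 then 1 else 0) = (if y = 2 \<or> y = 4 then 1 else (0::nat)) \<or>
      (if x = 2 \<or> x = 3 then 1 else 0) = (if y = 2 \<or> y = 3 then 1 else (0::nat))"
    unfolding less5 by auto
next
  fix L :: "nat \<Rightarrow> nat" and l
  assume L: "L \<in> {\<lambda>x. if x = 3 \<or> x = 4 then 1 else 0, \<lambda>x. if x = 2 \<or> x = 4 then 1 else 0,
    \<lambda>x. if x = 2 \<or> x = 3 then 1 else 0}"
  have less5: "x < 5 \<longleftrightarrow> x = 0 \<or> x = 1 \<or> x = 2 \<or> x = 3 \<or> x = 4" for x :: nat by linarith
  have "{x. x < 5 \<and> L x = l} \<subseteq> set [0, 1, 2] \<or> {x. x < 5 \<and> L x = l} \<subseteq> set [0, 1, 3]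
      \<or> {x. x < 5 \<and> L x = l} \<subseteq> set [0, 1, 4] \<or> {x. x < 5 \<and> L x = l} \<subseteq> set [2, 3, 4]"
    using L unfolding less5 by (cases "l = 0") auto
  then have "card {x. x < 5 \<and> L x = l} \<le> 3"
    by (elim disjE) (drule card_le_length, simp)+
  then show "card {x. x < 5 \<and> L x = l} < card (verts G)" using G(2) by simp
qed (rule that)

lemma spanning_lower_bound:
  assumes G: "connected_graph G" "card (verts G) \<ge> 3" and m: "m = card (verts G)"
  obtains col where "col \<in> nsets {..<m} 2 \<rightarrow> {1..3}" "\<not> has_mono_copy m col G"
proof (rule label_lower_bound[OF G(1), of m "\<lambda>x. if x = 0 then 1 else 0"
      "\<lambda>x. if x = 0 then 1 else x" "\<lambda>x. if x = 1 then 1 else 0"])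
  fix x y :: nat assume "x < m" "y < m" "x \<noteq> y"
  then show "(if x = 0 then 1 else 0) = (if y = 0 then 1 else (0::nat)) \<or>
      (if x = 0 then 1 else x) = (if y = 0 then 1 else y) \<or>
      (if x = 1 then 1 else 0) = (if y = 1 then 1 else (0::nat))"
    by auto
next
  fix L :: "nat \<Rightarrow> nat" and l
  assume L: "L \<in> {\<lambda>x. if x = 0 then 1 else 0, \<lambda>x. if x = 0 then 1 else x, \<lambda>x. if x = 1 then 1 else 0}"
  have "\<exists>y<m. L y \<noteq> l"
  proof -
    have "L 0 \<noteq> L 1 \<or> L 0 \<noteq> L 2" using L by auto
    then show ?thesis using G(2) m
      by (metis (full_types) One_nat_def Suc_1 Suc_le_eq eval_nat_numeral(3) less_trans lessI zero_less_Suc order_less_le_trans)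
  qed
  then have "{x. x < m \<and> L x = l} \<subset> {..<m}" by auto
  then have "card {x. x < m \<and> L x = l} < card {..<m}" by (intro psubset_card_mono) auto
  then show "card {x. x < m \<and> L x = l} < card (verts G)" by (simp add: m)
qed (rule that)

lemma ramsey_number_2_gt_card:
  assumes G: "connected_graph G" and \<chi>: "chromatic_number G \<ge> 3"
  shows "card (verts G) < ramsey_number 2 G"
proof (rule ccontr)
  let ?m = "card (verts G)"
  have fin: "fin_graph G" using connected_graphD[OF G] by blast
  define col where "col = (\<lambda>e::nat set. if 0 \<in> e then 2 else (1::nat))"
  assume "\<not> ?m < ramsey_number 2 G"
  then have "has_mono_copy ?m col G"
    by (intro ramsey_number_mono_copy[OF fin, where k = 2]) (auto simp: col_def)
  then obtain \<phi> k where \<phi>: "inj_on \<phi> (verts G)" "\<phi> ` verts G \<subseteq> {..<?m}"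
    "\<And>e. e \<in> edges G \<Longrightarrow> col (\<phi> ` e) = k"
    using has_mono_copyE[OF fin] by metis
  have m3: "?m \<ge> 3" using \<chi> chromatic_number_le_card[OF fin] by linarith
  have "card (\<phi> ` verts G) = card {..<?m}" using \<phi>(1) by (simp add: card_image)
  then have "\<phi> ` verts G = {..<?m}" using \<phi>(2) by (intro card_subset_eq) auto
  then obtain u where u: "u \<in> verts G" "\<phi> u = 0" using m3
    by (metis (no_types, lifting) imageE lessThan_iff less_le_trans zero_less_numeral)
  obtain v where "{u, v} \<in> edges G" using connected_graph_neighbour[OF G _ u(1)] m3 by auto
  then have k: "k = 2" using \<phi>(3)[of "{u, v}"] u(2) by (simp add: col_def)
  have "(\<lambda>v. if \<phi> v = 0 then 0 else 1) \<in> proper_colorings G 2"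
  proof -
    have "(\<phi> x = 0) \<noteq> (\<phi> y = 0)" if "{x, y} \<in> edges G" for x y
    proof -
      note xy = fin_graph_edgeD[OF fin that]
      have "\<phi> x \<noteq> \<phi> y" using \<phi>(1) xy by (auto dest: inj_onD)
      moreover have "0 \<in> {\<phi> x, \<phi> y}" using \<phi>(3)[OF that] k by (auto simp: col_def split: if_splits)
      ultimately show ?thesis by auto
    qed
    then show ?thesis by (auto simp: proper_colorings_def)
  qed
  then show False using chromatic_number_le \<chi> by fastforce
qed

lemma surplus_lower_bound:
  assumes G: "connected_graph G" and g: "card (verts G) \<ge> 2"
  defines "r \<equiv> ramsey_number 2 G - 1"
  defines "m \<equiv> (chromatic_number G - 1) * r + (chromatic_surplus G - 1)"
  obtains col where "col \<in> nsets {..<m} 2 \<rightarrow> {1..3}" "\<not> has_mono_copy m col G"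
proof -
  let ?\<chi> = "chromatic_number G" and ?\<sigma> = "chromatic_surplus G"
  have fin: "fin_graph G" "finite (verts G)" using connected_graphD[OF G] by blast+
  have R: "card (verts G) \<le> ramsey_number 2 G" by (rule card_verts_le_ramsey_number[OF fin(1)]) simp
  then have r: "r < ramsey_number 2 G" "r > 0" using g by (auto simp: r_def)
  have \<chi>: "?\<chi> \<ge> 2" by (rule chromatic_number_ge2[OF G g])
  have "?\<chi> * ?\<sigma> \<le> card (verts G)" by (rule chromatic_number_times_surplus_le[OF fin(1)])
  then have "?\<sigma> \<le> card (verts G)" using \<chi>
    by (metis Suc_1 Suc_leD Suc_le_lessD le_trans mult_le_mono1 nat_mult_1 nle_le)
  then have \<sigma>: "?\<sigma> - 1 \<le> r" using R by (simp add: r_def)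
  have m_le: "m \<le> ?\<chi> * r"
  proof -
    have "m \<le> (?\<chi> - 1) * r + r" using \<sigma> by (simp add: m_def)
    also have "\<dots> = ?\<chi> * r" using \<chi> by (cases ?\<chi>) auto
    finally show ?thesis .
  qed
  obtain col' where col': "col' \<in> nsets {..<r} 2 \<rightarrow> {1..2}" "\<not> has_mono_copy r col' G"
    using less_ramsey_number[OF r(1)] .
  define col where "col = (\<lambda>e. if card ((\<lambda>x. x div r) ` e) = 1 then col' ((\<lambda>x. x mod r) ` e) else 3)"
  have col_same: "col {x, y} = col' {x mod r, y mod r}" if "x div r = y div r" for x y
    using that by (simp add: col_def)
  have col_diff: "col {x, y} = 3" if "x div r \<noteq> y div r" for x y
    using that by (simp add: col_def)
  have col'_range: "col' {x mod r, y mod r} \<in> {1..2}" if "x div r = y div r" "x \<noteq> y" for x y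
  proof -
    have "x mod r \<noteq> y mod r" using that by (metis mult_div_mod_eq)
    then have "{x mod r, y mod r} \<in> nsets {..<r} 2" using r(2) by simp
    then show ?thesis using col'(1) by blast
  qed
  have "col \<in> nsets {..<m} 2 \<rightarrow> {1..3}"
  proof
    fix e assume "e \<in> nsets {..<m} 2"
    then obtain x y where xy: "e = {x, y}" "x \<noteq> y" by (auto elim: nsets2_E)
    show "col e \<in> {1..3}"
    proof (cases "x div r = y div r")
      case True
      then show ?thesis using col_same[OF True] col'_range[OF True xy(2)] xy(1) by simp
    next
      case False
      then show ?thesis using col_diff[OF False] xy(1) by simp
    qed
  qed
  moreover have "\<not> has_mono_copy m col G"
  proof
    assume "has_mono_copy m col G"
    then obtain \<phi> k where \<phi>: "inj_on \<phi> (verts G)" "\<phi> ` verts G \<subseteq> {..<m}"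
      "\<And>e. e \<in> edges G \<Longrightarrow> col (\<phi> ` e) = k"
      using has_mono_copyE[OF fin(1)] by metis
    have edge: "\<phi> x \<noteq> \<phi> y" "col {\<phi> x, \<phi> y} = k" if "{x, y} \<in> edges G" for x y
      using fin_graph_edgeD[OF fin(1) that] \<phi>(1) \<phi>(3)[OF that] by (auto dest: inj_onD)
    show False
    proof (cases "k = 3")
      case True
      define c where "c = (\<lambda>v. \<phi> v div r)"
      have proper: "c x \<noteq> c y" if "{x, y} \<in> edges G" for x y
        using edge[OF that] col_same[of "\<phi> x" "\<phi> y"] col'_range[of "\<phi> x" "\<phi> y"] True
        by (auto simp: c_def)
      have range: "c v < ?\<chi>" if "v \<in> verts G" for v
      proof -
        have "\<phi> v < ?\<chi> * r" using \<phi>(2) that m_le by (meson image_subset_iff lessThan_iff less_le_trans)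
        then show ?thesis by (simp add: c_def less_mult_imp_div_less)
      qed
      have c: "c \<in> proper_colorings G ?\<chi>" using proper range by (auto simp: proper_colorings_def)
      let ?S = "{v \<in> verts G. c v = ?\<chi> - 1}"
      have "\<phi> ` ?S \<subseteq> {(?\<chi> - 1) * r ..< m}"
      proof
        fix x assume "x \<in> \<phi> ` ?S"
        then have "x div r = ?\<chi> - 1" "x < m" using \<phi>(2) by (auto simp: c_def)
        then show "x \<in> {(?\<chi> - 1) * r ..< m}" by (metis atLeastLessThan_iff div_times_less_eq_dividend)
      qed
      then have "card (\<phi> ` ?S) \<le> ?\<sigma> - 1"
        by (metis (no_types, lifting) card_atLeastLessThan card_mono diff_add_inverse finite_atLeastLessThan m_def)
      moreover have "card (\<phi> ` ?S) = card ?S"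
        by (intro card_image inj_on_subset[OF \<phi>(1)]) auto
      moreover have "?\<sigma> \<le> card ?S" by (rule chromatic_surplus_le[OF c]) (use \<chi> in simp)
      ultimately have "card ?S = 0" by linarith
      then have "?S = {}" using fin(2) by simp
      then have "c v < ?\<chi> - 1" if "v \<in> verts G" for v using range[OF that] that by fastforce
      with proper have "c \<in> proper_colorings G (?\<chi> - 1)" by (auto simp: proper_colorings_def)
      then show False using chromatic_number_le \<chi> by fastforce
    next
      case False
      have "\<phi> x div r = \<phi> y div r" if "{x, y} \<in> edges G" for x y
        using edge[OF that] col_diff[of "\<phi> x" "\<phi> y"] False by auto
      then have same: "\<phi> u div r = \<phi> v div r" if "u \<in> verts G" "v \<in> verts G" for u v
        using connected_graph_label_const[OF G, of "\<lambda>x. \<phi> x div r"] that by blast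
      have "has_mono_copy r col' G"
      proof (rule has_mono_copyI[OF fin(1)])
        show "inj_on (\<lambda>v. \<phi> v mod r) (verts G)"
        proof (rule inj_onI)
          fix u v assume uv: "u \<in> verts G" "v \<in> verts G" "\<phi> u mod r = \<phi> v mod r"
          with same have "\<phi> u = \<phi> v" by (metis mult_div_mod_eq)
          then show "u = v" using \<phi>(1) uv by (auto dest: inj_onD)
        qed
        show "(\<lambda>v. \<phi> v mod r) ` verts G \<subseteq> {..<r}" using r(2) by auto
        fix e assume e: "e \<in> edges G"
        obtain x y where xy: "e = {x, y}" "x \<in> verts G" "y \<in> verts G" "x \<noteq> y"
          using fin(1) e by (rule fin_graph_edgeE)
        then show "col' ((\<lambda>v. \<phi> v mod r) ` e) = k"
          using col_same[OF same[OF xy(2,3)]] edge(2)[of x y] e by simp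
      qed
      with col'(2) show False by blast
    qed
  qed
  ultimately show thesis using that by blast
qed

section \<open>Dominant and almost monochromatic colorings\<close>

lemma dominant_copies:
  fixes col :: "nat set \<Rightarrow> nat"
  assumes G: "connected_graph G" and g: "card (verts G) \<ge> 2"
    and n: "n \<ge> ramsey_number 2 G + t * chromatic_number G * card (verts G)"
    and dom: "\<And>x y z. x < n \<Longrightarrow> y < n \<Longrightarrow> z < n \<Longrightarrow> x \<noteq> y \<Longrightarrow> x \<noteq> z \<Longrightarrow>
      col {x, y} = k \<or> col {x, z} = k \<or> col {x, y} = col {x, z}"
  shows "\<exists>\<Phi> j. copies G {..<n} {..<Suc t} \<Phi> \<and> (\<forall>i<Suc t. \<forall>e\<in>edges G. col (\<Phi> i ` e) = j)"
proof -
  let ?\<chi> = "chromatic_number G" and ?g = "card (verts G)"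
  have fin: "fin_graph G" "finite (verts G)" using connected_graphD[OF G] by blast+
  have \<chi>: "?\<chi> \<ge> 2" by (rule chromatic_number_ge2[OF G g])
  define pack where "pack = (\<lambda>a::nat. \<exists>\<Phi>. copies G {..<n} {..<a} \<Phi> \<and> (\<forall>i<a. \<forall>e\<in>edges G. col (\<Phi> i ` e) = k))"
  show ?thesis
  proof (cases "pack (Suc t)")
    case True
    then show ?thesis by (auto simp: pack_def)
  next
    case False
    have "pack 0" by (auto simp: pack_def copies_def)
    have "\<exists>a\<le>t. pack a \<and> \<not> pack (Suc a)"
    proof (rule ccontr)
      assume *: "\<not> ?thesis"
      have "pack a" if "a \<le> Suc t" for a
        using that by (induction a) (use * \<open>pack 0\<close> in auto)
      with False show False by blast
    qed
    then obtain a where a: "a \<le> t" "pack a" "\<not> pack (Suc a)" by blast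
    obtain \<Phi> where \<Phi>: "copies G {..<n} {..<a} \<Phi>" "\<forall>i<a. \<forall>e\<in>edges G. col (\<Phi> i ` e) = k"
      using a(2) by (auto simp: pack_def)
    define U where "U = {..<n} - (\<Union>i<a. \<Phi> i ` verts G)"
    have U: "U \<subseteq> {..<n}" "finite U" by (auto simp: U_def)
    have "card (\<Union>i<a. \<Phi> i ` verts G) \<le> (\<Sum>i<a. card (\<Phi> i ` verts G))" by (rule card_UN_le) simp
    also have "\<dots> \<le> (\<Sum>i<a. ?g)" by (intro sum_mono card_image_le fin)
    finally have "card (\<Union>i<a. \<Phi> i ` verts G) \<le> a * ?g" by simp
    moreover have "card U \<ge> card {..<n} - card (\<Union>i<a. \<Phi> i ` verts G)"
      unfolding U_def by (intro diff_card_le_card_Diff) (use fin in auto)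
    ultimately have "card U \<ge> n - a * ?g" by simp
    moreover have "a \<le> t * ?\<chi>" using a(1) \<chi>
      by (metis Suc_1 Suc_leD le_trans mult.right_neutral mult_le_mono2 One_nat_def)
    then have "t * ?\<chi> * ?g = (t * ?\<chi> - a) * ?g + a * ?g" by (simp add: add_mult_distrib[symmetric])
    ultimately have cardU: "card U \<ge> ramsey_number 2 G + (t * ?\<chi> - a) * ?g" using n by linarith
    have no_k: "\<not> (\<forall>e\<in>edges G. col (\<phi> ` e) = k)" if \<phi>: "inj_on \<phi> (verts G)" "\<phi> ` verts G \<subseteq> U" for \<phi>
    proof
      assume k: "\<forall>e\<in>edges G. col (\<phi> ` e) = k"
      have "\<phi> ` verts G \<inter> \<Phi> j ` verts G = {}" if "j \<in> {..<a}" for j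
        using \<phi>(2) that by (auto simp: U_def)
      then have "copies G {..<n} (insert a {..<a}) (\<Phi>(a := \<phi>))"
        using \<Phi>(1) \<phi> U(1) by (intro copies_insert) auto
      then have "copies G {..<n} {..<Suc a} (\<Phi>(a := \<phi>))" by (simp only: lessThan_Suc)
      moreover have "\<forall>i<Suc a. \<forall>e\<in>edges G. col ((\<Phi>(a := \<phi>)) i ` e) = k"
        using \<Phi>(2) k by (auto simp: less_Suc_eq)
      ultimately show False using a(3) by (auto simp: pack_def)
    qed
    define Q where "Q = (\<lambda>\<phi>. \<exists>j. j \<noteq> k \<and> (\<forall>e\<in>edges G. col (\<phi> ` e) = j))"
    have "\<exists>\<phi>. inj_on \<phi> (verts G) \<and> \<phi> ` verts G \<subseteq> W \<and> Q \<phi>"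
      if W: "W \<subseteq> U" "card W \<ge> ramsey_number 2 G" for W
    proof -
      have "finite W" using W(1) U(2) finite_subset by blast
      then obtain \<phi> where \<phi>: "inj_on \<phi> (verts G)" "\<phi> ` verts G \<subseteq> W"
        "(\<forall>e\<in>edges G. col (\<phi> ` e) = k) \<or> (\<forall>e\<in>edges G. col (\<phi> ` e) \<noteq> k)"
        using ramsey_number_2_subset[OF fin(1) _ W(2), of "\<lambda>e. col e = k"] by blast
      have "\<phi> ` verts G \<subseteq> U" using \<phi>(2) W(1) by blast
      with no_k \<phi> have not_k: "\<forall>e\<in>edges G. col (\<phi> ` e) \<noteq> k" by blast
      have lt: "\<phi> v < n" if "v \<in> verts G" for v using that \<phi>(2) W(1) U(1) by blast
      have adj: "col {\<phi> x, \<phi> y} = col {\<phi> x, \<phi> z}" if "{x, y} \<in> edges G" "{x, z} \<in> edges G" for x y z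
      proof -
        note v = fin_graph_edgeD[OF fin(1) that(1)] fin_graph_edgeD[OF fin(1) that(2)]
        have "\<phi> x \<noteq> \<phi> y" "\<phi> x \<noteq> \<phi> z" using \<phi>(1) v by (auto dest: inj_onD)
        moreover have "col {\<phi> x, \<phi> y} \<noteq> k" "col {\<phi> x, \<phi> z} \<noteq> k"
          using not_k that by (metis image_empty image_insert)+
        ultimately show ?thesis using dom[of "\<phi> x" "\<phi> y" "\<phi> z"] lt v by blast
      qed
      define L where "L = (\<lambda>x. col {\<phi> x, \<phi> (SOME y. {x, y} \<in> edges G)})"
      have L: "L x = col {\<phi> x, \<phi> y}" if "{x, y} \<in> edges G" for x y
        unfolding L_def by (rule adj[OF someI[of "\<lambda>y. {x, y} \<in> edges G", OF that] that])
      have L': "L x = L y" if "{x, y} \<in> edges G" for x y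
        using L[OF that] L[of y x] that by (simp add: insert_commute)
      obtain u where u: "u \<in> verts G" using connected_graphD(3)[OF G] by (auto simp: card_gt_0_iff)
      have "col (\<phi> ` e) = L u" if e: "e \<in> edges G" for e
      proof -
        obtain x y where xy: "e = {x, y}" "x \<in> verts G" "y \<in> verts G" "x \<noteq> y"
          using fin(1) e by (rule fin_graph_edgeE)
        then have "col (\<phi> ` e) = L x" using L[of x y] e by simp
        also have "L x = L u" by (rule connected_graph_label_const[OF G L' xy(2) u])
        finally show ?thesis .
      qed
      moreover obtain v where "{u, v} \<in> edges G" using connected_graph_neighbour[OF G g u] .
      ultimately have "Q \<phi>" using not_k unfolding Q_def by metis
      then show ?thesis using \<phi>(1,2) by blast
    qed
    from copies_greedy[OF U(2) cardU fin(2) this]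
    obtain \<Psi> where \<Psi>: "copies G U {..<Suc (t * ?\<chi> - a)} \<Psi>" "\<forall>i<Suc (t * ?\<chi> - a). Q (\<Psi> i)"
      by blast
    define A where "A = {..<Suc (t * ?\<chi> - a)}"
    have \<Psi>A: "inj_on (\<Psi> i) (verts G)" "\<Psi> i ` verts G \<subseteq> U" if "i \<in> A" for i
      using \<Psi>(1) that by (auto simp: copies_def A_def)
    have \<Psi>_disj: "\<Psi> i ` verts G \<inter> \<Psi> j ` verts G = {}" if "i \<in> A" "j \<in> A" "i \<noteq> j" for i j
      using \<Psi>(1) that by (auto simp: copies_def A_def)
    obtain \<kappa> where \<kappa>: "\<And>i. i \<in> A \<Longrightarrow> \<kappa> i \<noteq> k" "\<And>i e. i \<in> A \<Longrightarrow> e \<in> edges G \<Longrightarrow> col (\<Psi> i ` e) = \<kappa> i"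
      using \<Psi>(2) unfolding Q_def A_def by (metis lessThan_iff)
    have cross: "col {\<Psi> i v, \<Psi> j w} = k"
      if ij: "i \<in> A" "j \<in> A" "\<kappa> i \<noteq> \<kappa> j" and vw: "v \<in> verts G" "w \<in> verts G" for i j v w
    proof (rule ccontr)
      assume c: "col {\<Psi> i v, \<Psi> j w} \<noteq> k"
      have lt: "\<Psi> i v < n" if "i \<in> A" "v \<in> verts G" for i v using \<Psi>A(2) that U(1) by blast
      have ne: "\<Psi> i v \<noteq> \<Psi> j w" using \<Psi>_disj[of i j] ij vw by blast
      have own: "col {\<Psi> i v, z} = \<kappa> i"
        if v: "i \<in> A" "v \<in> verts G" "z < n" "z \<noteq> \<Psi> i v" "col {\<Psi> i v, z} \<noteq> k" for i v z
      proof -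
        obtain u where u: "{v, u} \<in> edges G" using connected_graph_neighbour[OF G g v(2)] .
        note vu = fin_graph_edgeD[OF fin(1) u]
        have "col {\<Psi> i v, \<Psi> i u} = \<kappa> i" using \<kappa>(2)[OF that(1) u] by simp
        moreover have "\<Psi> i v \<noteq> \<Psi> i u" using \<Psi>A(1)[OF that(1)] vu by (auto dest: inj_onD)
        ultimately show ?thesis
          using dom[of "\<Psi> i v" "\<Psi> i u" z] lt that vu \<kappa>(1)[OF that(1)] by metis
      qed
      have "col {\<Psi> i v, \<Psi> j w} = \<kappa> i" using own[of i v "\<Psi> j w"] ij vw lt ne c by auto
      moreover have "col {\<Psi> j w, \<Psi> i v} = \<kappa> j"
        using own[of j w "\<Psi> i v"] ij vw lt ne c by (auto simp: insert_commute)
      ultimately show False using ij(3) by (simp add: insert_commute)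
    qed
    have few: "card (\<kappa> ` A) < ?\<chi>"
    proof (rule ccontr)
      assume "\<not> ?thesis"
      then obtain B where B: "B \<subseteq> \<kappa> ` A" "card B = ?\<chi>" "finite B"
        by (meson not_less obtain_subset_with_card_n)
      then obtain h where h: "bij_betw h {..<?\<chi>} B"
        using ex_bij_betw_nat_finite[OF B(3)] by (auto simp: atLeast0LessThan)
      have "\<exists>i. i \<in> A \<and> \<kappa> i = h j" if "j < ?\<chi>" for j
        using h B(1) that by (force simp: bij_betw_def)
      then obtain f where f: "\<And>j. j < ?\<chi> \<Longrightarrow> f j \<in> A \<and> \<kappa> (f j) = h j" by metis
      have f_ne: "\<kappa> (f i) \<noteq> \<kappa> (f j)" if "i < ?\<chi>" "j < ?\<chi>" "i \<noteq> j" for i j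
        using f that h by (auto simp: bij_betw_def inj_on_def)
      obtain c where c: "c \<in> proper_colorings G ?\<chi>" using chromatic_number_proper[OF fin(1)] by blast
      note cD = proper_coloringD[OF c]
      \<comment> \<open>One color class of \<open>G\<close> from each of \<open>\<chi>(G)\<close> copies of different colors.\<close>
      define \<theta> where "\<theta> = (\<lambda>v. \<Psi> (f (c v)) v)"
      have "inj_on \<theta> (verts G)"
      proof (rule inj_onI)
        fix v w assume vw: "v \<in> verts G" "w \<in> verts G" "\<theta> v = \<theta> w"
        show "v = w"
        proof (cases "c v = c w")
          case True
          then show ?thesis
            using \<Psi>A(1)[of "f (c w)"] f cD(1) vw by (auto simp: \<theta>_def dest: inj_onD)
        next
          case False
          then have "f (c v) \<noteq> f (c w)" using f_ne[of "c v" "c w"] cD(1) vw by auto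
          then have "\<Psi> (f (c v)) ` verts G \<inter> \<Psi> (f (c w)) ` verts G = {}"
            using \<Psi>_disj f cD(1) vw by blast
          then show ?thesis using vw by (auto simp: \<theta>_def)
        qed
      qed
      moreover have "\<theta> ` verts G \<subseteq> U" using \<Psi>A(2) f cD(1) by (force simp: \<theta>_def)
      moreover have "col (\<theta> ` e) = k" if e: "e \<in> edges G" for e
      proof -
        obtain x y where xy: "e = {x, y}" "x \<in> verts G" "y \<in> verts G" "x \<noteq> y"
          using fin(1) e by (rule fin_graph_edgeE)
        then show ?thesis
          using cross[of "f (c x)" "f (c y)" x y] f f_ne[of "c x" "c y"] cD e by (simp add: \<theta>_def)
      qed
      ultimately show False using no_k by blast
    qed
    have "finite A" "A \<noteq> {}" by (auto simp: A_def)
    then have "\<exists>j\<in>\<kappa> ` A. card ({i \<in> A. \<kappa> i = j}) \<ge> Suc t"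
    proof -
      have "card A = (\<Sum>j\<in>\<kappa> ` A. card {i \<in> A. \<kappa> i = j})"
        using sum.image_gen[OF \<open>finite A\<close>, of "\<lambda>_. 1::nat" \<kappa>] by simp
      moreover have "t * card (\<kappa> ` A) < card A"
      proof -
        have "t * card (\<kappa> ` A) \<le> t * (?\<chi> - 1)" using few by (intro mult_le_mono2) simp
        also have "\<dots> = t * ?\<chi> - t" by (simp add: diff_mult_distrib2)
        also have "\<dots> < Suc (t * ?\<chi> - a)" using a(1) by simp
        finally show ?thesis by (simp add: A_def)
      qed
      moreover have "(\<Sum>j\<in>\<kappa> ` A. card {i \<in> A. \<kappa> i = j}) \<le> (\<Sum>j\<in>\<kappa> ` A. t)"
        if "\<And>j. j \<in> \<kappa> ` A \<Longrightarrow> card {i \<in> A. \<kappa> i = j} \<le> t"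
        using that by (rule sum_mono)
      ultimately obtain j where "j \<in> \<kappa> ` A" "card {i \<in> A. \<kappa> i = j} > t"
        by (metis linorder_not_le mult.commute sum_constant of_nat_id)
      then show ?thesis using Suc_le_eq by blast
    qed
    then obtain j where j: "card ({i \<in> A. \<kappa> i = j}) \<ge> Suc t" by blast
    then obtain f where f: "f ` {..<Suc t} \<subseteq> {i \<in> A. \<kappa> i = j}" "inj_on f {..<Suc t}"
      using card_le_inj[of "{..<Suc t}" "{i \<in> A. \<kappa> i = j}"] \<open>finite A\<close> by auto
    have fA: "f i \<in> A" "\<kappa> (f i) = j" if "i < Suc t" for i using f(1) that by auto
    have "copies G {..<n} {..<Suc t} (\<lambda>i. \<Psi> (f i))"
      unfolding copies_def
    proof (intro conjI ballI impI)
      fix i i' assume i: "i \<in> {..<Suc t}" "i' \<in> {..<Suc t}" "i \<noteq> i'"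
      then have "f i \<noteq> f i'" using f(2) by (auto dest: inj_onD)
      then show "\<Psi> (f i) ` verts G \<inter> \<Psi> (f i') ` verts G = {}" using \<Psi>_disj fA i by simp
    next
      fix i assume "i \<in> {..<Suc t}"
      then have "f i \<in> A" using fA by simp
      then show "inj_on (\<Psi> (f i)) (verts G)" "\<Psi> (f i) ` verts G \<subseteq> {..<n}"
        using \<Psi>A U(1) by blast+
    qed
    moreover have "\<forall>i<Suc t. \<forall>e\<in>edges G. col (\<Psi> (f i) ` e) = j" using fA \<kappa>(2) by metis
    ultimately show ?thesis by blast
  qed
qed

lemma almost_mono_has_copy:
  fixes col :: "nat set \<Rightarrow> nat"
  assumes H: "fin_graph H" and I: "I \<subseteq> verts H" "card I \<le> 3"
    and indep: "\<And>e. e \<in> edges H \<Longrightarrow> \<not> e \<subseteq> I"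
    and n: "card (verts H) + 4 \<le> n + card I"
    and abcd: "distinct [a, b, c, d]" "{a, b, c, d} \<subseteq> {..<n}"
    and mono: "\<And>u v. u < n \<Longrightarrow> v < n \<Longrightarrow> u \<noteq> a \<Longrightarrow> v \<noteq> a \<Longrightarrow> u \<noteq> v \<Longrightarrow> \<not> {u, v} \<subseteq> {b, c, d} \<Longrightarrow> col {u, v} = k"
  shows "has_mono_copy n col H"
proof -
  have finV: "finite (verts H)" using H by (simp add: fin_graph_def)
  have finI: "finite I" using I(1) finV finite_subset by blast
  have "card {b, c, d} = 3" using abcd(1) by simp
  then obtain f where f: "f ` I \<subseteq> {b, c, d}" "inj_on f I"
    using card_le_inj[of I "{b, c, d}"] finI I(2) by auto
  have "card {a, b, c, d} = 4" using abcd(1) by simp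
  then have "card ({..<n} - {a, b, c, d}) = n - 4" using abcd(2) by (simp add: card_Diff_subset)
  moreover have "card (verts H - I) = card (verts H) - card I" using I(1) finI by (simp add: card_Diff_subset)
  ultimately have "card (verts H - I) \<le> card ({..<n} - {a, b, c, d})" using n by linarith
  then obtain h where h: "h ` (verts H - I) \<subseteq> {..<n} - {a, b, c, d}" "inj_on h (verts H - I)"
    using card_le_inj[of "verts H - I" "{..<n} - {a, b, c, d}"] finV by auto
  define \<phi> where "\<phi> = (\<lambda>v. if v \<in> I then f v else h v)"
  have in_I: "\<phi> v \<in> {b, c, d}" if "v \<in> I" for v using that f(1) by (auto simp: \<phi>_def)
  have out_I: "\<phi> v \<in> {..<n} - {a, b, c, d}" if "v \<in> verts H - I" for v
    using that h(1) unfolding \<phi>_def by auto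
  have inj: "inj_on \<phi> (verts H)"
  proof (rule inj_onI)
    fix v w assume vw: "v \<in> verts H" "w \<in> verts H" "\<phi> v = \<phi> w"
    show "v = w"
    proof (cases "v \<in> I \<longleftrightarrow> w \<in> I")
      case True
      then show ?thesis using vw f(2) h(2) by (auto simp: \<phi>_def dest: inj_onD split: if_splits)
    next
      case False
      then show ?thesis using vw in_I[of v] in_I[of w] out_I[of v] out_I[of w] by auto
    qed
  qed
  have lt: "\<phi> v < n" "\<phi> v \<noteq> a" if "v \<in> verts H" for v
    using in_I[of v] out_I[of v] that abcd by auto
  show ?thesis
  proof (rule has_mono_copyI[OF H inj])
    show "\<phi> ` verts H \<subseteq> {..<n}" using lt by auto
    fix e assume e: "e \<in> edges H"
    obtain x y where xy: "e = {x, y}" "x \<in> verts H" "y \<in> verts H" "x \<noteq> y"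
      using H e by (rule fin_graph_edgeE)
    have "x \<notin> I \<or> y \<notin> I" using indep[OF e] xy by auto
    then have "\<not> {\<phi> x, \<phi> y} \<subseteq> {b, c, d}" using out_I[of x] out_I[of y] xy by auto
    moreover have "\<phi> x \<noteq> \<phi> y" using inj xy by (auto dest: inj_onD)
    ultimately show "col (\<phi> ` e) = k" using mono[of "\<phi> x" "\<phi> y"] lt xy by simp
  qed
qed

section \<open>The constrained Ramsey number\<close>

lemma path_graph_5_edges: "edges (path_graph 5) = {{0, 1}, {1, 2}, {2, 3}, {3, 4}}"
proof -
  have "edges (path_graph 5) = (\<lambda>i. {i, Suc i}) ` {i. Suc i < 5}"
    by (auto simp: path_graph_def)
  also have "{i. Suc i < 5} = {0, 1, 2, 3}" by auto
  finally show ?thesis by (simp add: eval_nat_numeral)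
qed

lemma has_rainbow_copy_P5I:
  assumes d: "distinct [u, v, w, x, y]" and V: "{u, v, w, x, y} \<subseteq> {..<n}"
    and c: "distinct [col {u, v}, col {v, w}, col {w, x}, col {x, y}]"
  shows "has_rainbow_copy n col (path_graph 5)"
proof -
  define \<phi> where "\<phi> = (\<lambda>i. [u, v, w, x, y] ! i)"
  have \<phi>: "\<phi> 0 = u" "\<phi> 1 = v" "\<phi> 2 = w" "\<phi> 3 = x" "\<phi> 4 = y"
    by (simp_all add: \<phi>_def numeral_eq_Suc)
  have "inj_on \<phi> {..<5}"
    using d unfolding \<phi>_def by (intro inj_on_nth) auto
  moreover have "\<phi> ` {..<5} \<subseteq> {..<n}"
  proof
    fix z assume "z \<in> \<phi> ` {..<5}"
    then obtain i where i: "i < 5" "z = [u, v, w, x, y] ! i" by (auto simp: \<phi>_def)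
    have "i < length [u, v, w, x, y]" using i(1) by simp
    then have "z \<in> set [u, v, w, x, y]" unfolding i(2) by (rule nth_mem)
    then show "z \<in> {..<n}" using V by auto
  qed
  moreover have "\<phi> ` e \<in> nsets {..<n} 2" if "e \<in> edges (path_graph 5)" for e
    using that d V unfolding path_graph_5_edges by (elim insertE emptyE) (simp_all add: \<phi> del: One_nat_def)
  moreover have "verts (path_graph 5) = {..<5}" by (simp add: path_graph_def)
  ultimately have "embedding \<phi> (path_graph 5) (complete_graph n)"
    by (simp add: embedding_def)
  moreover have "col (\<phi> ` e) \<noteq> col (\<phi> ` e')"
    if "e \<in> edges (path_graph 5)" "e' \<in> edges (path_graph 5)" "e \<noteq> e'" for e e'
    using that c unfolding path_graph_5_edges
    by (elim insertE emptyE) (simp_all add: \<phi> del: One_nat_def)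
  ultimately show ?thesis by (auto simp: has_rainbow_copy_def)
qed

lemma three_colors_no_rainbow_P5:
  assumes col: "col \<in> nsets {..<n} 2 \<rightarrow> {1..3}"
  shows "\<not> has_rainbow_copy n col (path_graph 5)"
proof
  assume "has_rainbow_copy n col (path_graph 5)"
  then obtain \<phi> where \<phi>: "\<And>e. e \<in> edges (path_graph 5) \<Longrightarrow> \<phi> ` e \<in> nsets {..<n} 2"
    "inj_on (\<lambda>e. col (\<phi> ` e)) (edges (path_graph 5))"
    unfolding has_rainbow_copy_def embedding_def inj_on_def by fastforce
  have "card (edges (path_graph 5)) \<le> card {1..3::nat}"
    by (rule card_inj_on_le[OF \<phi>(2)]) (use \<phi>(1) col in auto)
  moreover have "card (edges (path_graph 5)) = 4"
    unfolding path_graph_5_edges by (simp add: card_insert_if doubleton_eq_iff)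
  ultimately show False by simp
qed

lemma bipartite_independent_set:
  assumes G: "fin_graph G" and c: "chromatic_number G = 2"
  obtains J where "J \<subseteq> verts G" "card (verts G) \<le> 2 * card J" "\<And>e. e \<in> edges G \<Longrightarrow> \<not> e \<subseteq> J"
proof -
  obtain c where c: "c \<in> proper_colorings G 2" using chromatic_number_proper[OF G] c by auto
  define J where "J = (\<lambda>i. {v \<in> verts G. c v = (i::nat)})"
  have fin: "finite (verts G)" using G by (simp add: fin_graph_def)
  have indep: "\<not> e \<subseteq> J i" if e: "e \<in> edges G" for e i
  proof -
    obtain x y where "e = {x, y}" "x \<in> verts G" "y \<in> verts G" "x \<noteq> y"
      using G e by (rule fin_graph_edgeE)
    then show ?thesis using proper_coloringD(2)[OF c, of x y] e by (auto simp: J_def)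
  qed
  have "verts G = J 0 \<union> J 1"
    using proper_coloringD(1)[OF c] by (fastforce simp: J_def less_2_cases_iff)
  then have "card (verts G) \<le> card (J 0) + card (J 1)" using card_Un_le by metis
  then have "card (verts G) \<le> 2 * card (J 0) \<or> card (verts G) \<le> 2 * card (J 1)" by linarith
  then show thesis using that[of "J 0"] that[of "J 1"] indep by (auto simp: J_def)
qed

theorem theorem1p8:
  fixes G :: "'a sgraph" and Gs :: "'a sgraph list" and t :: nat
  assumes "connected_graph G"
    and "length Gs = t"
    and "\<And>i. i < t \<Longrightarrow> connected_graph (Gs ! i)"
    and "\<And>i. i < t \<Longrightarrow> is_subgraph (Gs ! i) G"
    and "real t \<le>
      ((real (chromatic_number G) - 2) * (real (ramsey_number 2 G) - 1)
         + real (chromatic_surplus G) - 1)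
      / (real (chromatic_number G) * real (card (verts G)))"
  shows "constrained_ramsey_number (disjoint_union (G # Gs)) (path_graph 5)
           = ramsey_number 3 (disjoint_union (G # Gs))"
proof -
  define H where "H = disjoint_union (G # Gs)"
  define n where "n = ramsey_number 3 H"
  define g where "g = card (verts G)"
  define \<chi> where "\<chi> = chromatic_number G"
  define \<sigma> where "\<sigma> = chromatic_surplus G"
  define R where "R = ramsey_number 2 G"
  have G: "connected_graph G" "fin_graph G" "finite (verts G)" "g > 0"
    using assms(1) connected_graphD[OF assms(1)] by (simp_all add: g_def)
  have comp: "fin_graph ((G # Gs) ! i)" "is_subgraph ((G # Gs) ! i) G" if "i < length (G # Gs)" for i
  proof -
    have "is_subgraph G G" unfolding is_subgraph_def embedding_def by (intro exI[of _ id]) simp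
    then show "fin_graph ((G # Gs) ! i)" "is_subgraph ((G # Gs) ! i) G"
      using that assms(2) G(2) connected_graphD(1)[OF assms(3)[of "i - 1"]] assms(4)[of "i - 1"]
      by (cases i; simp)+
  qed
  have H: "fin_graph H" unfolding H_def by (rule fin_graph_disjoint_union) (rule comp)
  have lower: "m < n" if "col \<in> nsets {..<m} 2 \<rightarrow> {1..3}" "\<not> has_mono_copy m col G" for m col
  proof (rule ccontr)
    assume "\<not> m < n"
    then have "has_mono_copy m col H"
      using ramsey_number_mono_copy[OF H that(1)] by (simp add: n_def)
    then show False
      using has_mono_copy_component[of m col "G # Gs" 0] that(2) by (simp add: H_def)
  qed
  have \<chi>\<sigma>: "\<chi> * \<sigma> \<le> g" "\<chi> \<le> g" "g \<le> R"
    using chromatic_number_times_surplus_le[OF G(2)] chromatic_number_le_card[OF G(2)]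
      card_verts_le_ramsey_number[OF G(2), of 2] by (simp_all add: \<chi>_def \<sigma>_def g_def R_def)
  have t: "real t \<le> ((real \<chi> - 2) * (real R - 1) + real \<sigma> - 1) / (real \<chi> * real g)"
    using assms(5) by (simp add: \<chi>_def \<sigma>_def g_def R_def)
  have main: "has_mono_copy n col H \<or> has_rainbow_copy n col (path_graph 5)" for col
  proof (cases "g \<le> 2")
    case True
    have "(real \<chi> - 2) * (real R - 1) + real \<sigma> - 1 \<le> 0 \<or> \<chi> = 0"
    proof (cases "g = 1")
      case True
      then have "\<chi> = 0 \<or> \<chi> = 1" using \<chi>\<sigma>(2) by auto
      then have "\<chi> = 0 \<or> \<chi> = 1 \<and> \<sigma> \<le> 1" using \<chi>\<sigma>(1) True by auto
      then show ?thesis using \<chi>\<sigma>(3) True by auto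
    next
      case False
      then have "g = 2" using True G(4) by simp
      then have "\<chi> = 2" using chromatic_number_ge2[OF G(1)] \<chi>\<sigma>(2) by (simp add: \<chi>_def g_def)
      then show ?thesis using \<chi>\<sigma>(1) \<open>g = 2\<close> by simp
    qed
    then have "((real \<chi> - 2) * (real R - 1) + real \<sigma> - 1) / (real \<chi> * real g) \<le> 0"
      by (auto intro: divide_nonpos_nonneg)
    with t have "t = 0" by simp
    then have Gs: "Gs = []" using assms(2) by simp
    have "e = verts G" if e: "e \<in> edges G" for e
    proof -
      have "e \<in> nsets (verts G) 2" using G(2) e by (auto simp: fin_graph_def)
      then show ?thesis using True G(3) by (intro card_seteq) (auto simp: nsets_def g_def)
    qed
    then have same: "e = e'" if "e \<in> edges H" "e' \<in> edges H" for e e'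
      using that by (auto simp: H_def Gs disjoint_union_simps)
    have "has_mono_copy n (\<lambda>_. 1) H"
      by (rule ramsey_number_mono_copy[OF H, where k = 3]) (auto simp: n_def)
    then have "has_mono_copy n col H" using same unfolding has_mono_copy_def by metis
    then show ?thesis by blast
  next
    case False
    then have g3: "g \<ge> 3" by simp
    have \<chi>2: "\<chi> \<ge> 2" using chromatic_number_ge2[OF G(1)] g3 by (simp add: \<chi>_def g_def)
    have n_surplus: "(\<chi> - 1) * (R - 1) + (\<sigma> - 1) < n"
    proof -
      have "2 \<le> card (verts G)" using g3 by (simp add: g_def)
      from surplus_lower_bound[OF G(1) this] lower show ?thesis
        unfolding \<chi>_def R_def \<sigma>_def by blast
    qed
    have n_card: "g < n"
      using spanning_lower_bound[OF G(1) _ refl] lower g3 unfolding g_def by blast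
    have n5: "4 < n"
      using K4_lower_bound[OF G(1)] lower g3 unfolding g_def by blast
    have n6: "5 < n" if "g \<ge> 4"
      using K5_lower_bound[OF G(1)] lower that unfolding g_def by blast
    have n_\<chi>3: "2 * g < n" if "\<chi> \<ge> 3"
    proof -
      have "g \<le> R - 1" using ramsey_number_2_gt_card[OF G(1)] that by (simp add: \<chi>_def g_def R_def)
      then have "2 * g \<le> (\<chi> - 1) * (R - 1)" using that by (intro mult_le_mono) auto
      then show ?thesis using n_surplus by linarith
    qed
    have n_t: "R + t * \<chi> * g \<le> n"
    proof -
      have pos: "real \<chi> * real g > 0" using \<chi>2 g3 by simp
      have "real t * (real \<chi> * real g) \<le> (real \<chi> - 2) * (real R - 1) + real \<sigma> - 1"
        using t pos by (simp add: pos_le_divide_eq)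
      also have "\<dots> \<le> (real \<chi> - 2) * (real R - 1) + real (\<sigma> - 1)" by simp
      also have "\<dots> = real ((\<chi> - 2) * (R - 1) + (\<sigma> - 1))"
        using \<chi>2 g3 \<chi>\<sigma>(3) by (simp add: of_nat_diff)
      finally have "real (t * \<chi> * g) \<le> real ((\<chi> - 2) * (R - 1) + (\<sigma> - 1))"
        by (simp add: mult.assoc)
      then have "t * \<chi> * g \<le> (\<chi> - 2) * (R - 1) + (\<sigma> - 1)" by (simp only: of_nat_le_iff)
      moreover have "(\<chi> - 1) * (R - 1) = (\<chi> - 2) * (R - 1) + (R - 1)"
      proof -
        have "\<chi> - 1 = Suc (\<chi> - 2)" using \<chi>2 by simp
        then show ?thesis by simp
      qed
      moreover have "R \<ge> 1" using \<chi>\<sigma>(3) g3 by simp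
      ultimately show ?thesis using n_surplus by linarith
    qed
    have union: "has_mono_copy n col H"
      if "copies G {..<n} {..<Suc t} \<Phi>" "\<forall>i<Suc t. \<forall>e\<in>edges G. col (\<Phi> i ` e) = j" for \<Phi> j
      unfolding H_def
      by (rule has_mono_copy_disjoint_union[OF comp, where \<Phi> = \<Phi> and k = j]) (use that assms(2) in auto)
    show ?thesis
    proof (rule disjCI)
      assume no: "\<not> has_rainbow_copy n col (path_graph 5)"
      interpret rainbow_P5_free "{..<n}" col
      proof
        fix u v w x y
        assume "distinct [u, v, w, x, y]" "{u, v, w, x, y} \<subseteq> {..<n}"
        then show "\<not> distinct [col {u, v}, col {v, w}, col {w, x}, col {x, y}]"
          using has_rainbow_copy_P5I[of u v w x y n col] no by blast
      qed
      show "has_mono_copy n col H"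
      proof (cases "\<exists>\<alpha> \<beta> \<gamma>. \<forall>e\<in>nsets {..<n} 2. col e \<in> {\<alpha>, \<beta>, \<gamma>}")
        case True
        then obtain \<alpha> \<beta> \<gamma> where abc: "\<And>e. e \<in> nsets {..<n} 2 \<Longrightarrow> col e \<in> {\<alpha>, \<beta>, \<gamma>}" by blast
        define col' where "col' = (\<lambda>e. if col e = \<alpha> then 1 else if col e = \<beta> then 2 else (3::nat))"
        have "has_mono_copy n col' H"
          by (rule ramsey_number_mono_copy[OF H, where k = 3]) (auto simp: n_def col'_def)
        then obtain \<phi> where \<phi>: "embedding \<phi> H (complete_graph n)"
          "\<forall>e\<in>edges H. \<forall>e'\<in>edges H. col' (\<phi> ` e) = col' (\<phi> ` e')"
          by (auto simp: has_mono_copy_def)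
        have "col (\<phi> ` e) = col (\<phi> ` e')" if "e \<in> edges H" "e' \<in> edges H" for e e'
        proof -
          have "\<phi> ` e \<in> nsets {..<n} 2" "\<phi> ` e' \<in> nsets {..<n} 2"
            using \<phi>(1) that by (auto simp: embedding_def)
          moreover have "col' (\<phi> ` e) = col' (\<phi> ` e')" using \<phi>(2) that by blast
          ultimately show ?thesis using abc[of "\<phi> ` e"] abc[of "\<phi> ` e'"]
            by (auto simp: col'_def split: if_splits)
        qed
        with \<phi>(1) show ?thesis by (auto simp: has_mono_copy_def)
      next
        case False
        have many: "\<exists>x\<in>{..<n}. \<exists>y\<in>{..<n}. x \<noteq> y \<and> col {x, y} \<notin> {\<alpha>, \<beta>, \<gamma>}" for \<alpha> \<beta> \<gamma>
        proof -
          obtain e where e: "e \<in> nsets {..<n} 2" "col e \<notin> {\<alpha>, \<beta>, \<gamma>}" using False by blast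
          from e(1) obtain x y where "e = {x, y}" "x \<in> {..<n}" "y \<in> {..<n}" "x \<noteq> y"
            by (rule nsets2_E)
          with e(2) show ?thesis by blast
        qed
        show ?thesis
        proof (cases "n \<ge> 6")
          case True
          then have "card {..<n} \<ge> 6" by simp
          from dominant_or_almost_mono[OF this many] obtain k
            where "dominant k \<or> almost_mono k" by blast
          then show ?thesis
          proof
            assume "dominant k"
            then have dom: "col {x, y} = k \<or> col {x, z} = k \<or> col {x, y} = col {x, z}"
              if "x < n" "y < n" "z < n" "x \<noteq> y" "x \<noteq> z" for x y z
              using that by (auto simp: dominant_def)
            have "\<exists>\<Phi> j. copies G {..<n} {..<Suc t} \<Phi> \<and> (\<forall>i<Suc t. \<forall>e\<in>edges G. col (\<Phi> i ` e) = j)"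
            proof (rule dominant_copies[OF G(1), where k = k])
              show "2 \<le> card (verts G)" using g3 by (simp add: g_def)
              show "ramsey_number 2 G + t * chromatic_number G * card (verts G) \<le> n"
                using n_t by (simp add: g_def R_def \<chi>_def)
            qed (rule dom)
            then show ?thesis using union by blast
          next
            assume "almost_mono k"
            then obtain a b c d where abcd: "distinct [a, b, c, d]" "{a, b, c, d} \<subseteq> {..<n}"
              and mono: "\<forall>u\<in>{..<n} - {a}. \<forall>v\<in>{..<n} - {a}. u \<noteq> v \<longrightarrow> \<not> {u, v} \<subseteq> {b, c, d} \<longrightarrow> col {u, v} = k"
              unfolding almost_mono_def by (elim exE conjE) (rule that)
            have mono': "col {u, v} = k"
              if "u < n" "v < n" "u \<noteq> a" "v \<noteq> a" "u \<noteq> v" "\<not> {u, v} \<subseteq> {b, c, d}" for u v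
              using mono[rule_format, of u v] that by simp
            have copy: ?thesis if "I \<subseteq> verts H" "card I \<le> 3" "\<And>e. e \<in> edges H \<Longrightarrow> \<not> e \<subseteq> I"
                "card (verts H) + 4 \<le> n + card I" for I
              by (rule almost_mono_has_copy[OF H that abcd]) (assumption, rule mono')
            have copy1: ?thesis if "card (verts H) + 3 \<le> n"
            proof -
              obtain v where v: "v \<in> verts G" using G(3,4) by (auto simp: g_def card_gt_0_iff)
              have "\<not> e \<subseteq> {(0, v)}" if e: "e \<in> edges H" for e
              proof -
                obtain x y where "e = {x, y}" "x \<in> verts H" "y \<in> verts H" "x \<noteq> y"
                  using H e by (rule fin_graph_edgeE)
                then show ?thesis by auto
              qed
              then show ?thesis
                using copy[of "{(0, v)}"] v that by (auto simp: H_def disjoint_union_simps)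
            qed
            have cardH: "card (verts H) \<le> Suc t * g"
            proof -
              have "card (verts H) = (\<Sum>i<Suc t. card (verts ((G # Gs) ! i)))"
                unfolding H_def disjoint_union_simps using comp(1) assms(2)
                by (subst card_SigmaI) (auto simp: fin_graph_def)
              also have "\<dots> \<le> (\<Sum>i<Suc t. g)"
              proof (rule sum_mono)
                fix i assume "i \<in> {..<Suc t}"
                then obtain \<psi> where "embedding \<psi> ((G # Gs) ! i) G"
                  using comp(2)[of i] assms(2) by (auto simp: is_subgraph_def)
                then show "card (verts ((G # Gs) ! i)) \<le> g"
                  unfolding g_def embedding_def using G(3) card_inj_on_le by blast
              qed
              finally show ?thesis by simp
            qed
            show ?thesis
            proof (cases "t = 0")
              case t0: False
              have "2 * (t * g) \<le> t * \<chi> * g" using \<chi>2 by simp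
              moreover have "g \<le> t * g" using t0 by simp
              ultimately have "Suc t * g + 3 \<le> n" unfolding mult_Suc using n_t \<chi>\<sigma>(3) g3 by linarith
              then show ?thesis using copy1 cardH by linarith
            next
              case True
              then have Gs: "Gs = []" using assms(2) by simp
              have VH: "verts H = Pair 0 ` verts G" "edges H = (\<lambda>e. Pair 0 ` e) ` edges G"
                by (auto simp: H_def Gs disjoint_union_simps)
              have cVH: "card (verts H) = g" by (simp add: VH card_image inj_on_def g_def)
              show ?thesis
              proof (cases "g + 3 \<le> n")
                case True
                then show ?thesis using copy1 cVH by simp
              next
                case False
                then have "g \<ge> 4" using \<open>n \<ge> 6\<close> by simp
                then have "\<chi> = 2" using n_\<chi>3 False \<chi>2 by (cases "\<chi> \<ge> 3") auto
                then obtain J where J: "J \<subseteq> verts G" "g \<le> 2 * card J" "\<And>e. e \<in> edges G \<Longrightarrow> \<not> e \<subseteq> J"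
                  using bipartite_independent_set[OF G(2)] by (auto simp: \<chi>_def g_def)
                define s where "s = (if g = 4 then 2 else 3::nat)"
                have s: "s \<le> card J" "s \<le> 3" "g + 4 \<le> n + s"
                  using J(2) \<open>g \<ge> 4\<close> \<open>n \<ge> 6\<close> n_card by (auto simp: s_def)
                obtain I where I: "I \<subseteq> J" "card I = s" using obtain_subset_with_card_n[OF s(1)] by blast
                have "\<not> Pair 0 ` e \<subseteq> Pair 0 ` I" if "e \<in> edges G" for e
                  using J(3)[OF that] I(1) by (auto simp: image_subset_iff)
                moreover have "card (Pair (0::nat) ` I) = s" using I(2) by (simp add: card_image inj_on_def)
                ultimately show ?thesis
                  using copy[of "Pair 0 ` I"] I(1) J(1) s cVH by (auto simp: VH)
              qed
            qed
          qed
        next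
          case False
          then have n: "n = 5" and g: "g = 3" using n5 n6 g3 by linarith+
          have "\<chi> = 2" using n_\<chi>3 n g \<chi>2 by (cases "\<chi> \<ge> 3") auto
          have "t = 0"
          proof (rule ccontr)
            assume "t \<noteq> 0"
            then have "1 * 2 * 3 \<le> t * \<chi> * g" using \<open>\<chi> = 2\<close> g by (intro mult_le_mono) auto
            then show False using n_t n by simp
          qed
          obtain x y z where xyz: "{x, y, z} \<subseteq> {..<n}" "distinct [x, y, z]" "col {x, y} = col {x, z}"
            using K5_incident_same_color[of 0 1 2 3 4] n by auto
          obtain J where J: "J \<subseteq> verts G" "g \<le> 2 * card J" "\<And>e. e \<in> edges G \<Longrightarrow> \<not> e \<subseteq> J"
            using bipartite_independent_set[OF G(2)] \<open>\<chi> = 2\<close> by (auto simp: \<chi>_def g_def)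
          have "2 \<le> card J" using J(2) g by simp
          then obtain I where I: "I \<subseteq> J" "card I = 2" using obtain_subset_with_card_n by metis
          then obtain p q where pq: "I = {p, q}" "p \<noteq> q" by (auto simp: card_2_iff)
          have pqV: "p \<in> verts G" "q \<in> verts G" using pq I(1) J(1) by auto
          have "card (verts G - I) = 1" using I J(1) G(3) g
            by (subst card_Diff_subset) (auto simp: g_def intro: finite_subset)
          then obtain u where u: "verts G - I = {u}" by (auto simp: card_1_singleton_iff)
          define \<phi> where "\<phi> = (\<lambda>v. if v = u then x else if v = p then y else z)"
          have V: "verts G = {u, p, q}" "u \<noteq> p" "u \<noteq> q" using u pq pqV by auto
          have \<phi>: "\<phi> u = x" "\<phi> p = y" "\<phi> q = z" using V pq by (auto simp: \<phi>_def)
          have "copies G {..<n} {..<Suc t} (\<lambda>_. \<phi>)"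
            using xyz \<phi> by (auto simp: copies_def V(1) \<open>t = 0\<close>)
          moreover have "col (\<phi> ` e) = col {x, y}" if e: "e \<in> edges G" for e
          proof -
            obtain v w where vw: "e = {v, w}" "v \<in> verts G" "w \<in> verts G" "v \<noteq> w"
              using G(2) e by (rule fin_graph_edgeE)
            have "\<not> e \<subseteq> {p, q}" using J(3)[OF e] I(1) pq by auto
            then have "e = {u, p} \<or> e = {u, q}" using vw V by auto
            then show ?thesis using \<phi> xyz(3) by auto
          qed
          ultimately show ?thesis using union[of "\<lambda>_. \<phi>"] by blast
        qed
      qed
    qed
  qed
  show ?thesis
    unfolding constrained_ramsey_number_def H_def[symmetric] n_def[symmetric]
  proof (rule Least_equality)
    show "\<forall>col. has_mono_copy n col H \<or> has_rainbow_copy n col (path_graph 5)" using main by blast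
    fix m assume "\<forall>col. has_mono_copy m col H \<or> has_rainbow_copy m col (path_graph 5)"
    then have "\<forall>col \<in> edges (complete_graph m) \<rightarrow> {1..3}. has_mono_copy m col H"
      using three_colors_no_rainbow_P5 by fastforce
    then show "n \<le> m" unfolding n_def ramsey_number_def by (rule Least_le)
  qed
qed

end
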